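(* Let $G$ be an amenable group, $A$ an abelian group, and $G\overset{\alpha}{\curvearrowright}A$ a left action by group endomorphisms. Let $N$ be a non-trivial normal subgroup of $G$ such that $G/N$ is infinite. (a) If $\mathrm{ent}(\alpha\restriction_N)<\infty$, then $\mathrm{ent}(\alpha)=0$. (b) If $h_{alg}(\alpha\restriction_N)<\infty$, then $h_{alg}(\alpha)=0$.
   Context: Groups are considered as discrete groups; amenability is the usual notion. A right Følner net of an amenable group $G$ is a net $(F_i)_{i\in I}$ of non-empty finite subsets of $G$ with $\lim_{i\in I}|F_ig\setminus F_i|/|F_i|=0$ for every $g\in G$. A left action $G\overset{\alpha}{\curvearrowright}A$ on an abelian group $A$ assigns to each $g\in G$ an endomorphism $\alpha(g)$ of $A$ with $\alpha(gh)=\alpha(g)\circ\alpha(h)$ and $\alpha(1)=\mathrm{id}_A$. For a subgroup $N\le G$, $\alpha\restriction_N$ is the restricted action of $N$ on $A$ (its entropy is computed with Følner nets of $N$). For non-empty finite $X\subseteq A$ and non-empty finite $F\subseteq G$ put $T_F(\alpha,X)=\sum_{g\in F}\alpha(g)(X)$ (sum of subsets). Set $H_{alg}(\alpha,X)=\lim_{i\in I}\frac{\log|T_{F_i}(\alpha,X)|}{|F_i|}$ for any right Følner net $(F_i)_{i\in I}$ of $G$; the limit is known to exist, to be finite, and not to depend on the net. Define $h_{alg}(\alpha)=\sup\{H_{alg}(\alpha,X):X\subseteq A\text{ non-empty finite}\}$ and $\mathrm{ent}(\alpha)=\sup\{H_{alg}(\alpha,X):X\text{ a finite subgroup of }A\}$,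 both in $[0,\infty]$. *)

theory Defs
  imports "HOL-Algebra.Coset" "HOL-Algebra.FiniteProduct" "HOL-Analysis.Analysis"
begin

text \<open>Amenability of a discrete group: there is a left-invariant finitely additive probability
  measure on the family of all subsets.\<close>

definition amenable_group :: "('g, 'm) monoid_scheme \<Rightarrow> bool" where
  "amenable_group G \<longleftrightarrow> group G \<and>
     (\<exists>\<mu> :: 'g set \<Rightarrow> real.
        \<mu> (carrier G) = 1 \<and>
        (\<forall>S. S \<subseteq> carrier G \<longrightarrow> 0 \<le> \<mu> S) \<and>
        (\<forall>S T. S \<subseteq> carrier G \<longrightarrow> T \<subseteq> carrier G \<longrightarrow> S \<inter> T = {} \<longrightarrow> \<mu> (S \<union> T) = \<mu> S + \<mu> T) \<and>
        (\<forall>g \<in> carrier G. \<forall>S. S \<subseteq> carrier G \<longrightarrow> \<mu> (g <#\<^bsub>G\<^esub> S) = \<mu> S))"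

text \<open>A net is a family \<open>F\<close> together with a proper filter \<open>I\<close> on its index type; for a directed
  index set, \<open>I\<close> is the filter generated by its tails.\<close>

definition right_folner_net :: "('g, 'm) monoid_scheme \<Rightarrow> 'i filter \<Rightarrow> ('i \<Rightarrow> 'g set) \<Rightarrow> bool" where
  "right_folner_net G I F \<longleftrightarrow> I \<noteq> bot \<and>
     (\<forall>\<^sub>F i in I. finite (F i) \<and> F i \<noteq> {} \<and> F i \<subseteq> carrier G) \<and>
     (\<forall>g \<in> carrier G. ((\<lambda>i. real (card ((F i #>\<^bsub>G\<^esub> g) - F i)) / real (card (F i))) \<longlongrightarrow> 0) I)"

text \<open>The abelian group \<open>A\<close> is a commutative group in the multiplicative notation of HOL-Algebra.\<close>

definition left_action ::
  "('g, 'm) monoid_scheme \<Rightarrow> ('a, 'n) monoid_scheme \<Rightarrow> ('g \<Rightarrow> 'a \<Rightarrow> 'a) \<Rightarrow> bool" where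
  "left_action G A \<alpha> \<longleftrightarrow>
     (\<forall>g \<in> carrier G. \<alpha> g \<in> hom A A) \<and>
     (\<forall>g \<in> carrier G. \<forall>h \<in> carrier G. \<forall>x \<in> carrier A. \<alpha> (g \<otimes>\<^bsub>G\<^esub> h) x = \<alpha> g (\<alpha> h x)) \<and>
     (\<forall>x \<in> carrier A. \<alpha> \<one>\<^bsub>G\<^esub> x = x)"

text \<open>The sum of the subsets \<open>\<alpha> g ` X\<close>, \<open>g \<in> F\<close>, i.e. the set of all sums of one element from each.\<close>

definition trajectory ::
  "('a, 'n) monoid_scheme \<Rightarrow> ('g \<Rightarrow> 'a \<Rightarrow> 'a) \<Rightarrow> 'g set \<Rightarrow> 'a set \<Rightarrow> 'a set" where
  "trajectory A \<alpha> F X = {finprod A y F | y. \<forall>g \<in> F. y g \<in> \<alpha> g ` X}"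

text \<open>The common limit along all right Folner nets. It suffices to let the nets be indexed
  by \<open>'g set\<close>: see \<open>right_folner_net_tendsto\<close> below.\<close>

definition H_alg ::
  "('g, 'm) monoid_scheme \<Rightarrow> ('a, 'n) monoid_scheme \<Rightarrow> ('g \<Rightarrow> 'a \<Rightarrow> 'a) \<Rightarrow> 'a set \<Rightarrow> real" where
  "H_alg G A \<alpha> X = (THE h. \<forall>(I :: 'g set filter) F. right_folner_net G I F \<longrightarrow>
     ((\<lambda>i. ln (real (card (trajectory A \<alpha> (F i) X))) / real (card (F i))) \<longlongrightarrow> h) I)"

definition h_alg ::
  "('g, 'm) monoid_scheme \<Rightarrow> ('a, 'n) monoid_scheme \<Rightarrow> ('g \<Rightarrow> 'a \<Rightarrow> 'a) \<Rightarrow> ereal" where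
  "h_alg G A \<alpha> =
     (SUP X \<in> {X. X \<subseteq> carrier A \<and> finite X \<and> X \<noteq> {}}. ereal (H_alg G A \<alpha> X))"

definition ent ::
  "('g, 'm) monoid_scheme \<Rightarrow> ('a, 'n) monoid_scheme \<Rightarrow> ('g \<Rightarrow> 'a \<Rightarrow> 'a) \<Rightarrow> ereal" where
  "ent G A \<alpha> = (SUP X \<in> {X. subgroup X A \<and> finite X}. ereal (H_alg G A \<alpha> X))"

lemma right_folner_net_filtermap:
  assumes "right_folner_net G I F"
  shows "right_folner_net G (filtermap F I) (\<lambda>E. E)"
  using assms unfolding right_folner_net_def
  by (simp add: filtermap_bot_iff eventually_filtermap filterlim_filtermap)

lemma right_folner_net_tendsto:
  fixes G :: "('g, 'm) monoid_scheme" and I :: "'i filter" and F :: "'i \<Rightarrow> 'g set"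
    and \<phi> :: "'g set \<Rightarrow> real"
  assumes "\<And>(J :: 'g set filter) E. right_folner_net G J E \<Longrightarrow> ((\<lambda>j. \<phi> (E j)) \<longlongrightarrow> h) J"
    and "right_folner_net G I F"
  shows "((\<lambda>i. \<phi> (F i)) \<longlongrightarrow> h) I"
  using assms(1)[OF right_folner_net_filtermap[OF assms(2)]] by (simp add: filterlim_filtermap)

end

theory Submission imports Defs begin

text \<open>Write \<open>f F = ln (card (trajectory A \<alpha> F X))\<close>. This function of finite sets \<open>F\<close> is monotone, subadditive
  and left invariant. If \<open>E\<close> consists of \<open>k\<close> representatives of distinct cosets of \<open>N\<close>, a bound \<open>C\<close> on the
  \<open>N\<close>-entropy of \<open>trajectory A \<alpha> E X\<close> gives finite \<open>F\<close> in \<open>N\<close> with \<open>f (F E) \<le> (C + 1) * card F\<close>,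
  hence \<open>f (F E) / card (F E) \<le> (C + 1) / k\<close>; so the infimum of \<open>f D / card D\<close> over finite \<open>D\<close> is \<open>0\<close>.
  Covering a Folner set greedily by translates of a set with small ratio, each adding a fixed
  proportion of new points, then shows that the limit along every Folner net of \<open>G\<close> is \<open>0\<close>.

  Reading a bound off \<open>H_alg\<close> for \<open>N\<close> requires the limit to exist. Its uniqueness comes from
  the existence of Folner nets: otherwise some finite set \<open>K\<close> doubles all finite sets, and Hall's theorem
  yields a paradoxical decomposition. Its existence is the Ornstein-Weiss lemma, obtained from quasi-tilings.\<close>

section \<open>Hall's theorem and amenability\<close>

text \<open>Rado's argument: a minimal relation satisfying Hall's condition is a function, because deleting
  either of two values of \<open>i\<close> would give tight finite sets, and submodularity of cardinality
  rules that out.\<close>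

lemma hall_matching:
  fixes R :: "('i \<times> 'b) set"
  assumes fin: "\<And>i. i \<in> I \<Longrightarrow> finite (R `` {i})"
    and hall: "\<And>J. J \<subseteq> I \<Longrightarrow> finite J \<Longrightarrow> card J \<le> card (R `` J)"
  shows "\<exists>\<phi>. inj_on \<phi> I \<and> (\<forall>i\<in>I. (i, \<phi> i) \<in> R)"
proof -
  \<comment> \<open>\<open>\<A>\<close> holds the sets of pairs that can be deleted without
    destroying Hall's condition. Ordering by deleted pairs lets Zorn's lemma work with unions of
    chains; a maximal \<open>Q\<close> leaves a minimal relation \<open>S\<close>.\<close>
  define \<A> where "\<A> = {Q. Q \<subseteq> R \<and> (\<forall>J. J \<subseteq> I \<longrightarrow> finite J \<longrightarrow> card J \<le> card ((R - Q) `` J))}"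
  have finJ: "finite (S `` J)" if "J \<subseteq> I" "finite J" "S \<subseteq> R" for J S
  proof -
    have "R `` J = (\<Union>i\<in>J. R `` {i})" by blast
    then have "finite (R `` J)" using that fin by auto
    moreover have "S `` J \<subseteq> R `` J" using that by blast
    ultimately show ?thesis by (rule rev_finite_subset)
  qed
  have "\<A> \<noteq> {}" unfolding \<A>_def using hall by (auto intro!: exI[of _ "{}"])
  moreover have "\<Union>\<C> \<in> \<A>" if C: "\<C> \<noteq> {}" "subset.chain \<A> \<C>" for \<C>
  proof -
    have sub: "\<C> \<subseteq> \<A>" using C(2) by (simp add: subset.chain_def)
    have "card J \<le> card ((R - \<Union>\<C>) `` J)" if J: "J \<subseteq> I" "finite J" for J
    proof -
      \<comment> \<open>Only finitely many pairs of \<open>R\<close> lie over the finite set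
        \<open>J\<close>, so the deletions affecting \<open>J\<close> already occur in one member of
        the chain.\<close>
      define D where "D = \<Union>\<C> \<inter> (J \<times> R `` J)"
      have "finite D" unfolding D_def using J finJ by blast
      moreover have "D \<subseteq> \<Union>\<C>" unfolding D_def by blast
      ultimately obtain Q where Q: "Q \<in> \<C>" "D \<subseteq> Q"
        using finite_subset_Union_chain[OF _ _ C] by metis
      have "(R - Q) `` J \<subseteq> (R - \<Union>\<C>) `` J" using Q unfolding D_def by blast
      then have "card ((R - Q) `` J) \<le> card ((R - \<Union>\<C>) `` J)"
        using J by (intro card_mono finJ) auto
      moreover have "card J \<le> card ((R - Q) `` J)" using Q(1) sub J unfolding \<A>_def by blast
      ultimately show ?thesis by simp
    qed
    then show ?thesis using sub unfolding \<A>_def by blast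
  qed
  ultimately obtain Q where Q: "Q \<in> \<A>" and max: "\<And>X. X \<in> \<A> \<Longrightarrow> Q \<subseteq> X \<Longrightarrow> X = Q"
    using subset_Zorn_nonempty[of \<A>] by blast
  define S where "S = R - Q"
  have SR: "S \<subseteq> R" unfolding S_def by blast
  have S: "card J \<le> card (S `` J)" if "J \<subseteq> I" "finite J" for J
    using Q that unfolding \<A>_def S_def by blast
  \<comment> \<open>By maximality of \<open>Q\<close>, deleting one more pair \<open>(i, x)\<close>
    breaks Hall's condition on some finite set. That set contains \<open>i\<close>, and dropping
    \<open>i\<close> turns the strict inequality into a weak one.\<close>
  have tight: "\<exists>J \<subseteq> I. finite J \<and> i \<notin> J \<and> card (S `` J \<union> (S `` {i} - {x})) \<le> card J"
    if "i \<in> I" and ix: "(i, x) \<in> S" for i x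
  proof -
    have "insert (i, x) Q \<notin> \<A>" using max[of "insert (i, x) Q"] that unfolding S_def by blast
    then obtain J where J: "J \<subseteq> I" "finite J" "card ((R - insert (i, x) Q) `` J) < card J"
      using Q subsetD[OF SR ix] unfolding \<A>_def by (auto simp: not_le)
    have "i \<in> J"
    proof (rule ccontr)
      assume "i \<notin> J"
      then have "(R - insert (i, x) Q) `` J = S `` J" unfolding S_def by blast
      then show False using J(3) S[OF J(1,2)] by simp
    qed
    have "(S `` (J - {i}) \<union> (S `` {i} - {x})) \<subseteq> (R - insert (i, x) Q) `` J"
      using \<open>i \<in> J\<close> unfolding S_def by blast
    then have "card (S `` (J - {i}) \<union> (S `` {i} - {x})) < card J"
      using card_mono[OF finJ[OF J(1,2) Diff_subset]] J(3) by (meson le_less_trans)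
    then have "card (S `` (J - {i}) \<union> (S `` {i} - {x})) \<le> card (J - {i})"
      using J(2) \<open>i \<in> J\<close> by simp
    then show ?thesis
      using J(1,2) by (intro exI[of _ "J - {i}"] conjI) auto
  qed
  have single: "x = y" if i: "i \<in> I" and xy: "(i, x) \<in> S" "(i, y) \<in> S" for i x y
  proof (rule ccontr)
    assume "x \<noteq> y"
    obtain J1 where J1: "J1 \<subseteq> I" "finite J1" "i \<notin> J1" "card (S `` J1 \<union> (S `` {i} - {x})) \<le> card J1"
      using tight[OF i xy(1)] by blast
    obtain J2 where J2: "J2 \<subseteq> I" "finite J2" "i \<notin> J2" "card (S `` J2 \<union> (S `` {i} - {y})) \<le> card J2"
      using tight[OF i xy(2)] by blast
    let ?P = "S `` J1 \<union> (S `` {i} - {x})" and ?Q = "S `` J2 \<union> (S `` {i} - {y})"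
    have finPQ: "finite ?P" "finite ?Q"
      using finJ[OF J1(1,2) SR] finJ[OF J2(1,2) SR] finJ[of "{i}" S] i SR by auto
    \<comment> \<open>Since \<open>x \<noteq> y\<close>, each set restores the value that the other
      omits. The extra index \<open>i\<close> gives an excess of one, which contradicts the
      tightness of both sets once unions and intersections are added up.\<close>
    have "?P \<union> ?Q = S `` insert i (J1 \<union> J2)" using \<open>x \<noteq> y\<close> by blast
    then have 1: "Suc (card (J1 \<union> J2)) \<le> card (?P \<union> ?Q)"
      using S[of "insert i (J1 \<union> J2)"] J1 J2 i by simp
    have "card (S `` (J1 \<inter> J2)) \<le> card (?P \<inter> ?Q)" using finPQ by (intro card_mono) auto
    then have 2: "card (J1 \<inter> J2) \<le> card (?P \<inter> ?Q)"
      using S[of "J1 \<inter> J2"] J1 by (meson finite_Int inf.coboundedI1 le_trans)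
    show False
      using card_Un_Int[OF finPQ] card_Un_Int[OF J1(2) J2(2)] 1 2 J1(4) J2(4) by linarith
  qed
  have "\<exists>x. (i, x) \<in> S" if "i \<in> I" for i
  proof -
    have "card (S `` {i}) \<noteq> 0" using S[of "{i}"] that by auto
    then have "S `` {i} \<noteq> {}" by force
    then show ?thesis by blast
  qed
  then obtain \<phi> where \<phi>: "\<And>i. i \<in> I \<Longrightarrow> (i, \<phi> i) \<in> S" by metis
  have "inj_on \<phi> I"
  proof (rule inj_onI, rule ccontr)
    fix i j assume ij: "i \<in> I" "j \<in> I" "\<phi> i = \<phi> j" "i \<noteq> j"
    have "S `` {i, j} \<subseteq> {\<phi> i}" using single \<phi> ij by fastforce
    then have "card (S `` {i, j}) \<le> 1" using card_mono[of "{\<phi> i}"] by fastforce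
    then show False using S[of "{i, j}"] ij by simp
  qed
  then show ?thesis using \<phi> SR by blast
qed

text \<open>Inversion exchanges left and right translations, so the new mean of \<open>S\<close> is
  the given mean of the set of inverses of \<open>S\<close>. Right invariance is the form that fits
  products \<open>F <#> K\<close>.\<close>

lemma (in group) amenable_right_mean:
  assumes "amenable_group G"
  obtains \<nu> :: "'a set \<Rightarrow> real" where "\<nu> (carrier G) = 1"
    and "\<And>S. S \<subseteq> carrier G \<Longrightarrow> 0 \<le> \<nu> S"
    and "\<And>S T. S \<subseteq> carrier G \<Longrightarrow> T \<subseteq> carrier G \<Longrightarrow> S \<inter> T = {} \<Longrightarrow> \<nu> (S \<union> T) = \<nu> S + \<nu> T"
    and "\<And>S g. S \<subseteq> carrier G \<Longrightarrow> g \<in> carrier G \<Longrightarrow> \<nu> (S #> g) = \<nu> S"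
proof -
  obtain \<mu> :: "'a set \<Rightarrow> real" where "\<mu> (carrier G) = 1"
    "\<forall>S. S \<subseteq> carrier G \<longrightarrow> 0 \<le> \<mu> S"
    "\<forall>S T. S \<subseteq> carrier G \<longrightarrow> T \<subseteq> carrier G \<longrightarrow> S \<inter> T = {} \<longrightarrow> \<mu> (S \<union> T) = \<mu> S + \<mu> T"
    "\<forall>g \<in> carrier G. \<forall>S. S \<subseteq> carrier G \<longrightarrow> \<mu> (g <# S) = \<mu> S"
    using assms unfolding amenable_group_def by (elim conjE exE) (rule that)
  note \<mu> = this(1) this(2-4)[rule_format]
  let ?\<nu> = "\<lambda>S. \<mu> (m_inv G ` S)"
  have inv_sub: "m_inv G ` S \<subseteq> carrier G" if "S \<subseteq> carrier G" for S using that by auto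
  show thesis
  proof (rule that[of ?\<nu>])
    have "x \<in> m_inv G ` carrier G" if "x \<in> carrier G" for x
      using imageI[OF inv_closed[OF that], of "m_inv G"] that by simp
    then have "m_inv G ` carrier G = carrier G" by auto
    then show "?\<nu> (carrier G) = 1" using \<mu>(1) by simp
    show "0 \<le> ?\<nu> S" if "S \<subseteq> carrier G" for S using \<mu>(2) inv_sub that by blast
    show "?\<nu> (S \<union> T) = ?\<nu> S + ?\<nu> T"
      if "S \<subseteq> carrier G" "T \<subseteq> carrier G" "S \<inter> T = {}" for S T
    proof -
      have inj: "inj_on (m_inv G) (carrier G)" by (metis inj_on_inverseI inv_inv)
      have "m_inv G ` S \<inter> m_inv G ` T = {}"
        unfolding inj_on_image_Int[OF inj that(1,2), symmetric] that(3) by simp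
      then show ?thesis using \<mu>(3)[OF inv_sub[OF that(1)] inv_sub[OF that(2)]] by (simp add: image_Un)
    qed
    show "?\<nu> (S #> g) = ?\<nu> S" if "S \<subseteq> carrier G" "g \<in> carrier G" for S g
    proof -
      have "m_inv G ` (S #> g) = inv g <# m_inv G ` S"
        unfolding r_coset_def l_coset_def image_UN image_insert image_empty UN_simps
        using that by (intro SUP_cong refl) (simp add: inv_mult_group subset_iff)
      then show ?thesis using \<mu>(4)[of "inv g" "m_inv G ` S"] inv_sub that by simp
    qed
  qed
qed

text \<open>If \<open>K\<close> doubled every finite set, Hall's theorem would give two injections
  of the group into itself with disjoint images, each moving points by right multiplication with
  elements of \<open>K\<close>. A right-invariant mean gives each image mass 1, hence their union
  mass 2.\<close>

lemma (in group) amenable_not_doubling: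
  assumes amen: "amenable_group G" and K: "finite K" "K \<subseteq> carrier G"
  shows "\<exists>F. finite F \<and> F \<subseteq> carrier G \<and> card (F <#> K) < 2 * card F"
proof (rule ccontr)
  assume "\<not> ?thesis"
  then have dbl: "2 * card F \<le> card (F <#> K)" if "finite F" "F \<subseteq> carrier G" for F
    using that not_le by blast
  obtain \<nu> :: "'a set \<Rightarrow> real" where \<nu>: "\<nu> (carrier G) = 1"
    "\<And>S. S \<subseteq> carrier G \<Longrightarrow> 0 \<le> \<nu> S"
    "\<And>S T. S \<subseteq> carrier G \<Longrightarrow> T \<subseteq> carrier G \<Longrightarrow> S \<inter> T = {} \<Longrightarrow> \<nu> (S \<union> T) = \<nu> S + \<nu> T"
    "\<And>S g. S \<subseteq> carrier G \<Longrightarrow> g \<in> carrier G \<Longrightarrow> \<nu> (S #> g) = \<nu> S"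
    using amenable_right_mean[OF amen] by metis
  \<comment> \<open>The Boolean tag makes two copies of every \<open>g\<close>, so an injective
    choice for all copies is a pair of injections with disjoint images.\<close>
  define R :: "(('a \<times> bool) \<times> 'a) set" where "R = {((g, b), g \<otimes> k) |g b k. g \<in> carrier G \<and> k \<in> K}"
  have "\<exists>\<phi>. inj_on \<phi> (carrier G \<times> UNIV) \<and> (\<forall>i \<in> carrier G \<times> UNIV. (i, \<phi> i) \<in> R)"
  proof (rule hall_matching)
    fix i :: "'a \<times> bool"
    have "R `` {i} \<subseteq> (\<lambda>k. fst i \<otimes> k) ` K" unfolding R_def by auto
    then show "finite (R `` {i})" using K finite_subset by blast
  next
    fix J :: "('a \<times> bool) set" assume J: "J \<subseteq> carrier G \<times> UNIV" "finite J"
    have "J \<subseteq> fst ` J \<times> UNIV" by force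
    then have "card J \<le> 2 * card (fst ` J)"
      using card_mono[of "fst ` J \<times> (UNIV :: bool set)" J] J by (simp add: card_cartesian_product)
    also have "\<dots> \<le> card (fst ` J <#> K)" using J by (intro dbl) auto
    also have "fst ` J <#> K = R `` J" using J unfolding R_def set_mult_def by force
    finally show "card J \<le> card (R `` J)" .
  qed
  then obtain \<phi> where inj: "inj_on \<phi> (carrier G \<times> UNIV)"
    and \<phi>: "\<And>g b. g \<in> carrier G \<Longrightarrow> ((g, b), \<phi> (g, b)) \<in> R" by blast
  have "\<forall>g b. \<exists>k. g \<in> carrier G \<longrightarrow> k \<in> K \<and> \<phi> (g, b) = g \<otimes> k"
    using \<phi> unfolding R_def by blast
  then obtain \<kappa> where \<kappa>: "\<And>g b. g \<in> carrier G \<Longrightarrow> \<kappa> g b \<in> K"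
    "\<And>g b. g \<in> carrier G \<Longrightarrow> \<phi> (g, b) = g \<otimes> \<kappa> g b" by metis
  let ?im = "\<lambda>b S. (\<lambda>g. \<phi> (g, b)) ` S"
  have im_sub: "?im b S \<subseteq> carrier G" if "S \<subseteq> carrier G" for b S
    using that \<kappa> K by (auto simp: subset_iff)
  \<comment> \<open>On the set where \<open>\<kappa> g b\<close> has a fixed value the map is a
    right translation and preserves the mean. As \<open>K\<close> is finite, finite additivity over
    these pieces suffices.\<close>
  have meas: "\<nu> (?im b {g \<in> carrier G. \<kappa> g b \<in> L}) = \<nu> {g \<in> carrier G. \<kappa> g b \<in> L}"
    if "finite L" "L \<subseteq> K" for b L
    using that
  proof (induction L rule: finite_induct)
    case empty
    then show ?case by simp
  next
    case (insert l L)
    let ?S = "{g \<in> carrier G. \<kappa> g b \<in> L}" and ?T = "{g \<in> carrier G. \<kappa> g b = l}"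
    have ST: "{g \<in> carrier G. \<kappa> g b \<in> insert l L} = ?S \<union> ?T" "?S \<inter> ?T = {}"
      "?S \<subseteq> carrier G" "?T \<subseteq> carrier G"
      using insert by auto
    have disj: "?im b ?S \<inter> ?im b ?T = {}"
      using inj_onD[OF inj] insert.hyps(2) by fastforce
    have "?im b ?T = ?T #> l" unfolding r_coset_def using \<kappa> by auto
    then have T: "\<nu> (?im b ?T) = \<nu> ?T" using \<nu>(4)[OF ST(4)] insert.prems K by auto
    show ?case
      unfolding ST(1) image_Un \<nu>(3)[OF im_sub[OF ST(3)] im_sub[OF ST(4)] disj] \<nu>(3)[OF ST(3,4,2)] T
      using insert by simp
  qed
  have full: "{g \<in> carrier G. \<kappa> g b \<in> K} = carrier G" for b using \<kappa> by blast
  have one: "\<nu> (?im b (carrier G)) = 1" for b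
    using meas[OF K(1) order.refl, of b] \<nu>(1) unfolding full by simp
  let ?U = "?im True (carrier G) \<union> ?im False (carrier G)"
  have "?im True (carrier G) \<inter> ?im False (carrier G) = {}"
    using inj by (auto simp: inj_on_def)
  then have "\<nu> ?U = 2" using \<nu>(3)[OF im_sub im_sub] one by simp
  moreover have "?U \<subseteq> carrier G" using im_sub by blast
  then have "\<nu> (carrier G) = \<nu> ?U + \<nu> (carrier G - ?U)"
    using \<nu>(3)[of ?U "carrier G - ?U"] by (simp add: Un_absorb1)
  moreover have "0 \<le> \<nu> (carrier G - ?U)" by (rule \<nu>(2)) blast
  ultimately show False using \<nu>(1) by simp
qed

text \<open>Growth by \<open>1 + \<delta>\<close> iterates: repeated multiplication by
  \<open>K\<close> would produce a finite set with growth factor \<open>(1 + \<delta>) ^ n\<close>,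
  which exceeds 2 for large \<open>n\<close>.\<close>

lemma (in group) amenable_almost_invariant:
  assumes amen: "amenable_group G" and K: "finite K" "K \<subseteq> carrier G" and "0 < \<delta>"
  shows "\<exists>F. finite F \<and> F \<subseteq> carrier G \<and> real (card (F <#> K)) < (1 + \<delta>) * real (card F)"
proof (rule ccontr)
  assume "\<not> ?thesis"
  then have grow: "(1 + \<delta>) * real (card F) \<le> real (card (F <#> K))" if "finite F" "F \<subseteq> carrier G" for F
    using that not_le by blast
  have pow: "\<exists>L. finite L \<and> L \<subseteq> carrier G \<and>
    (\<forall>F. finite F \<longrightarrow> F \<subseteq> carrier G \<longrightarrow> (1 + \<delta>) ^ n * real (card F) \<le> real (card (F <#> L)))" for n
  proof (induction n)
    case 0
    show ?case
      by (intro exI[of _ "{\<one>}"]) (auto simp: r_coset_eq_set_mult[symmetric])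
  next
    case (Suc n)
    then obtain L where L: "finite L" "L \<subseteq> carrier G"
      "\<And>F. finite F \<Longrightarrow> F \<subseteq> carrier G \<Longrightarrow> (1 + \<delta>) ^ n * real (card F) \<le> real (card (F <#> L))" by blast
    have "(1 + \<delta>) ^ Suc n * real (card F) \<le> real (card (F <#> (L <#> K)))"
      if F: "finite F" "F \<subseteq> carrier G" for F
    proof -
      have "(1 + \<delta>) ^ Suc n * real (card F) = (1 + \<delta>) * ((1 + \<delta>) ^ n * real (card F))" by simp
      also have "\<dots> \<le> (1 + \<delta>) * real (card (F <#> L))"
        using L(3)[OF F] \<open>0 < \<delta>\<close> by (intro mult_left_mono) auto
      also have "\<dots> \<le> real (card ((F <#> L) <#> K))"
        using F L set_mult_closed[OF F(2) L(2)] by (intro grow) (auto simp: set_mult_def)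
      finally show ?thesis using set_mult_assoc[OF F(2) L(2) K(2)] by simp
    qed
    moreover have "finite (L <#> K)" using L K by (auto simp: set_mult_def)
    ultimately show ?case using set_mult_closed[OF L(2) K(2)] by blast
  qed
  obtain n where n: "2 < (1 + \<delta>) ^ n" using real_arch_pow[of "1 + \<delta>" 2] \<open>0 < \<delta>\<close> by auto
  obtain L where L: "finite L" "L \<subseteq> carrier G"
    "\<And>F. finite F \<Longrightarrow> F \<subseteq> carrier G \<Longrightarrow> (1 + \<delta>) ^ n * real (card F) \<le> real (card (F <#> L))"
    using pow[of n] by (elim exE conjE) (rule that; blast)
  obtain F where F: "finite F" "F \<subseteq> carrier G" "card (F <#> L) < 2 * card F"
    using amenable_not_doubling[OF amen L(1,2)] by blast
  have "2 * real (card F) \<le> (1 + \<delta>) ^ n * real (card F)" using n by (intro mult_right_mono) auto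
  also have "\<dots> \<le> real (card (F <#> L))" using L(3) F by blast
  also have "\<dots> < 2 * real (card F)" using F(3) by linarith
  finally show False by simp
qed

section \<open>Folner sets\<close>

text \<open>For \<open>k\<close> in the group, right multiplication by \<open>k\<close> maps this
  set bijectively onto \<open>(D #> k) - D\<close>. It measures the same defect by points of
  \<open>D\<close> itself, which suits covering arguments.\<close>

definition escape :: "('g, 'm) monoid_scheme \<Rightarrow> 'g set \<Rightarrow> 'g \<Rightarrow> 'g set" where
  "escape G D k = {x \<in> D. x \<otimes>\<^bsub>G\<^esub> k \<notin> D}"

definition almost_inv :: "('g, 'm) monoid_scheme \<Rightarrow> 'g set \<Rightarrow> real \<Rightarrow> 'g set \<Rightarrow> bool" where
  "almost_inv G K \<delta> D \<longleftrightarrow> finite D \<and> D \<noteq> {} \<and> D \<subseteq> carrier G \<and>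
     (\<forall>k\<in>K. real (card (escape G D k)) \<le> \<delta> * real (card D))"

definition folner_condition :: "('g, 'm) monoid_scheme \<Rightarrow> bool" where
  "folner_condition G \<longleftrightarrow>
     (\<forall>K \<delta>. finite K \<longrightarrow> K \<subseteq> carrier G \<longrightarrow> 0 < \<delta> \<longrightarrow> (\<exists>D. almost_inv G K \<delta> D))"

lemma almost_inv_mono:
  assumes "almost_inv G K \<delta> D" "K' \<subseteq> K" "\<delta> \<le> \<delta>'"
  shows "almost_inv G K' \<delta>' D"
proof -
  have "\<delta> * real (card D) \<le> \<delta>' * real (card D)" using assms(3) by (intro mult_right_mono) auto
  then show ?thesis using assms unfolding almost_inv_def by (meson order_trans subsetD)
qed

lemma (in group) card_l_coset:
  assumes "a \<in> carrier G" "S \<subseteq> carrier G"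
  shows "card (a <# S) = card S"
proof -
  have "a <# S = (\<lambda>x. a \<otimes> x) ` S" unfolding l_coset_def by auto
  then show ?thesis using assms by (auto intro!: card_image inj_onI simp: subset_iff)
qed

lemma (in group) card_r_coset_diff:
  assumes "D \<subseteq> carrier G" "k \<in> carrier G"
  shows "card ((D #> k) - D) = card (escape G D k)"
proof -
  have "(D #> k) - D = (\<lambda>x. x \<otimes> k) ` escape G D k"
    unfolding r_coset_def escape_def by auto
  then show ?thesis using assms unfolding escape_def
    by (auto intro!: card_image inj_onI simp: subset_iff)
qed

text \<open>A set violating the Folner condition in \<open>H\<close> grows by a fixed factor; splitting a finite subset of
  \<open>G\<close> along left cosets of \<open>H\<close>, this growth passes to all finite subsets of \<open>G\<close>.\<close>

lemma (in group) folner_condition_subgroup: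
  assumes amen: "amenable_group G" and H: "subgroup H G"
  shows "folner_condition (G\<lparr>carrier := H\<rparr>)"
  unfolding folner_condition_def
proof (intro allI impI, rule ccontr)
  fix K and \<delta> :: real
  assume "finite K" and "K \<subseteq> carrier (G\<lparr>carrier := H\<rparr>)" and "0 < \<delta>"
    and no: "\<not> (\<exists>D. almost_inv (G\<lparr>carrier := H\<rparr>) K \<delta> D)"
  then have KH: "K \<subseteq> H" by simp
  have HG: "H \<subseteq> carrier G" using H by (rule subgroup.subset)
  have esc: "escape (G\<lparr>carrier := H\<rparr>) = escape G" by (simp add: escape_def fun_eq_iff)
  define K' where "K' = insert \<one> K"
  have K'H: "K' \<subseteq> H" using KH H unfolding K'_def by (simp add: subgroup.one_closed)
  have K': "finite K'" "K' \<subseteq> carrier G" using K'H HG \<open>finite K\<close> unfolding K'_def by auto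
  have fin: "finite (F <#> K')" if "finite F" for F using that K' by (auto simp: set_mult_def)
  have growH: "(1 + \<delta>) * real (card D) \<le> real (card (D <#> K'))"
    if D: "finite D" "D \<noteq> {}" "D \<subseteq> H" for D
  proof -
    have "\<not> almost_inv (G\<lparr>carrier := H\<rparr>) K \<delta> D" using no by blast
    then have "\<exists>k\<in>K. \<delta> * real (card D) < real (card (escape G D k))"
      using D unfolding almost_inv_def esc by (simp add: not_le)
    then obtain k where k: "k \<in> K" "\<delta> * real (card D) < real (card (escape G D k))" ..
    have DG: "D \<subseteq> carrier G" using D HG by blast
    have "D \<union> ((D #> k) - D) \<subseteq> D <#> K'"
    proof -
      have "x \<in> D <#> K'" if "x \<in> D" for x
        using that DG unfolding set_mult_def K'_def by simp (metis r_one subsetD)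
      moreover have "D #> k \<subseteq> D <#> K'"
        using k(1) unfolding set_mult_def r_coset_def K'_def by (intro UN_mono) auto
      ultimately show ?thesis by blast
    qed
    then have "card (D \<union> ((D #> k) - D)) \<le> card (D <#> K')"
      using fin[OF D(1)] by (rule card_mono[rotated])
    moreover have "card (D \<union> ((D #> k) - D)) = card D + card (escape G D k)"
      using card_r_coset_diff[OF DG, of k] k(1) KH HG D(1)
      by (subst card_Un_disjoint) (simp_all add: r_coset_def subset_iff)
    ultimately show ?thesis using k(2) by (simp add: algebra_simps)
  qed
  have grow: "(1 + \<delta>) * real (card F) \<le> real (card (F <#> K'))" if "finite F" "F \<subseteq> carrier G" for F
    using that
  proof (induction F rule: finite_psubset_induct)
    case (psubset F)
    show ?case
    proof (cases "F = {}")
      case True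
      then show ?thesis by simp
    next
      case False
      then obtain c where c: "c \<in> F" by blast
      then have cG: "c \<in> carrier G" using psubset.prems by blast
      \<comment> \<open>\<open>F1\<close> is the part of \<open>F\<close> in the left coset of
        \<open>c\<close>; translated by \<open>inv c\<close> it lies in \<open>H\<close>, where
        growth is known. The rest is a proper subset of \<open>F\<close>, which the induction
        hypothesis covers.\<close>
      define F1 where "F1 = {x \<in> F. inv c \<otimes> x \<in> H}"
      define F2 where "F2 = F - F1"
      have F1: "F1 \<subseteq> carrier G" "finite F1" and F2: "F2 \<subseteq> carrier G" "finite F2"
        using psubset.prems psubset.hyps unfolding F1_def F2_def by auto
      have "c \<in> F1" using c cG H unfolding F1_def by (simp add: subgroup.one_closed)
      then have "F2 \<subset> F" using c unfolding F2_def by blast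
      then have IH: "(1 + \<delta>) * real (card F2) \<le> real (card (F2 <#> K'))"
        using psubset.IH F2(1) by blast
      let ?D = "inv c <# F1"
      have "?D \<subseteq> H" unfolding l_coset_def F1_def by auto
      moreover have "finite ?D" "?D \<noteq> {}" using F1 \<open>c \<in> F1\<close> unfolding l_coset_def by auto
      ultimately have "(1 + \<delta>) * real (card ?D) \<le> real (card (?D <#> K'))" by (intro growH)
      moreover have "?D <#> K' = inv c <# (F1 <#> K')"
        using set_mult_assoc[of "{inv c}" F1 K'] F1 K' cG by (simp add: l_coset_eq_set_mult)
      ultimately have 1: "(1 + \<delta>) * real (card F1) \<le> real (card (F1 <#> K'))"
        using card_l_coset[of "inv c" F1] card_l_coset[of "inv c" "F1 <#> K'"] cG F1
          set_mult_closed[OF F1(1) K'(2)] by simp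
      \<comment> \<open>Right multiplication by elements of \<open>H\<close> preserves left cosets
        of \<open>H\<close>, so the two parts stay apart and their growth adds up.\<close>
      have "(F1 <#> K') \<inter> (F2 <#> K') = {}"
      proof (rule ccontr)
        assume "(F1 <#> K') \<inter> (F2 <#> K') \<noteq> {}"
        then obtain x k y l where *: "x \<in> F1" "k \<in> K'" "y \<in> F2" "l \<in> K'" "x \<otimes> k = y \<otimes> l"
          unfolding set_mult_def by blast
        have G: "x \<in> carrier G" "y \<in> carrier G" "k \<in> carrier G" "l \<in> carrier G"
          using * F1 F2 K' by auto
        have "y = x \<otimes> k \<otimes> inv l" using *(5) G by (simp add: inv_solve_right)
        then have "inv c \<otimes> y = (inv c \<otimes> x) \<otimes> (k \<otimes> inv l)" using G cG by (simp add: m_assoc)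
        moreover have "k \<otimes> inv l \<in> H"
          using * K'H H by (meson subgroup.m_closed subgroup.m_inv_closed subsetD)
        ultimately have "inv c \<otimes> y \<in> H" using *(1) H unfolding F1_def by (simp add: subgroup.m_closed)
        then show False using *(3) unfolding F2_def F1_def by blast
      qed
      moreover have "F <#> K' = (F1 <#> K') \<union> (F2 <#> K')" unfolding set_mult_def F2_def F1_def by blast
      ultimately have "card (F <#> K') = card (F1 <#> K') + card (F2 <#> K')"
        using fin F1 F2 by (simp add: card_Un_disjoint)
      moreover have "card F = card F1 + card F2"
      proof -
        have "F \<inter> F1 = F1" unfolding F1_def by blast
        then show ?thesis using card_Int_Diff[OF psubset.hyps, of F1] unfolding F2_def by simp
      qed
      ultimately show ?thesis using 1 IH by (simp add: algebra_simps)
    qed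
  qed
  show False
    using amenable_almost_invariant[OF amen K' \<open>0 < \<delta>\<close>] grow by (meson not_le)
qed

text \<open>The sets index themselves: the filter is generated by the families of almost invariant
  sets, which are directed by enlarging \<open>K\<close> and shrinking \<open>\<delta>\<close>, and
  non-empty by the Folner condition.\<close>

lemma (in group) ex_right_folner_net:
  assumes "folner_condition G"
  shows "\<exists>I :: 'a set filter. right_folner_net G I (\<lambda>D. D)"
proof -
  define B where "B = {K. finite K \<and> K \<subseteq> carrier G} \<times> {\<delta> :: real. 0 < \<delta>}"
  define P where "P = (\<lambda>p. {D. almost_inv G (fst p) (snd p) D})"
  define I where "I = (INF p\<in>B. principal (P p))"
  have "B \<noteq> {}" unfolding B_def by (auto intro: gt_ex)
  moreover have "\<exists>x\<in>B. principal (P x) \<le> inf (principal (P p)) (principal (P q))" if "p \<in> B" "q \<in> B" for p q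
    using that unfolding B_def P_def
    by (intro bexI[of _ "(fst p \<union> fst q, min (snd p) (snd q))"]) (auto intro: almost_inv_mono)
  ultimately have ev: "eventually Q I \<longleftrightarrow> (\<exists>p\<in>B. \<forall>D. almost_inv G (fst p) (snd p) D \<longrightarrow> Q D)" for Q
    unfolding I_def by (subst eventually_INF_base) (auto simp: eventually_principal P_def)
  have evI: "eventually (almost_inv G K \<delta>) I" if "finite K" "K \<subseteq> carrier G" "0 < \<delta>" for K \<delta>
    unfolding ev using that by (intro bexI[of _ "(K, \<delta>)"]) (auto simp: B_def)
  have "I \<noteq> bot"
    using assms unfolding trivial_limit_def ev folner_condition_def B_def by force
  moreover have "eventually (\<lambda>D. finite D \<and> D \<noteq> {} \<and> D \<subseteq> carrier G) I"
    by (rule eventually_mono[OF evI[of "{}" 1]]) (auto simp: almost_inv_def)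
  moreover have "((\<lambda>D. real (card ((D #> g) - D)) / real (card D)) \<longlongrightarrow> 0) I" if g: "g \<in> carrier G" for g
  proof (rule tendstoI)
    fix e :: real assume "0 < e"
    then have "eventually (almost_inv G {g} (e / 2)) I" using g by (intro evI) auto
    then show "\<forall>\<^sub>F D in I. dist (real (card ((D #> g) - D)) / real (card D)) 0 < e"
    proof (rule eventually_mono)
      fix D assume D: "almost_inv G {g} (e / 2) D"
      then have "0 < real (card D)" "real (card ((D #> g) - D)) \<le> e / 2 * real (card D)"
        using card_r_coset_diff[OF _ g] unfolding almost_inv_def by auto
      moreover from this have "e / 2 * real (card D) < e * real (card D)" using \<open>0 < e\<close> by simp
      ultimately show "dist (real (card ((D #> g) - D)) / real (card D)) 0 < e"
        by (simp add: divide_less_eq)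
    qed
  qed
  ultimately show ?thesis unfolding right_folner_net_def by blast
qed

lemma (in group) right_folner_net_almost_inv:
  assumes net: "right_folner_net G I F" and K: "finite K" "K \<subseteq> carrier G" and "0 < \<delta>"
  shows "\<forall>\<^sub>F i in I. almost_inv G K \<delta> (F i)"
proof -
  have "\<forall>\<^sub>F i in I. \<forall>k\<in>K. real (card ((F i #> k) - F i)) / real (card (F i)) < \<delta>"
    using net K \<open>0 < \<delta>\<close> unfolding right_folner_net_def
    by (intro eventually_ball_finite ballI order_tendstoD(2)[where a = \<delta>]) auto
  moreover have "\<forall>\<^sub>F i in I. finite (F i) \<and> F i \<noteq> {} \<and> F i \<subseteq> carrier G"
    using net unfolding right_folner_net_def by blast
  ultimately show ?thesis
  proof eventually_elim
    case (elim i)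
    then have pos: "0 < real (card (F i))" by (simp add: card_gt_0_iff)
    have "real (card (escape G (F i) k)) \<le> \<delta> * real (card (F i))" if k: "k \<in> K" for k
    proof -
      have "real (card ((F i #> k) - F i)) / real (card (F i)) < \<delta>" using elim k by blast
      moreover have "card ((F i #> k) - F i) = card (escape G (F i) k)"
        using elim k K by (intro card_r_coset_diff) auto
      ultimately show ?thesis using pos by (simp add: divide_less_eq)
    qed
    then show ?case using elim unfolding almost_inv_def by simp
  qed
qed

section \<open>The Ornstein-Weiss lemma\<close>

text \<open>Isolates the properties of \<open>ln (card (trajectory A \<alpha> F X))\<close> on which
  the limit argument rests. Left invariance is stated as an inequality; applying it to
  \<open>inv g\<close> gives equality.\<close>

locale left_subadditive = group G for G (structure) +
  fixes f :: "'a set \<Rightarrow> real"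
  assumes f_empty: "f {} = 0"
    and f_mono: "E \<subseteq> F \<Longrightarrow> finite F \<Longrightarrow> F \<subseteq> carrier G \<Longrightarrow> f E \<le> f F"
    and f_Un: "finite E \<Longrightarrow> finite F \<Longrightarrow> E \<subseteq> carrier G \<Longrightarrow> F \<subseteq> carrier G \<Longrightarrow> f (E \<union> F) \<le> f E + f F"
    and f_left: "g \<in> carrier G \<Longrightarrow> finite F \<Longrightarrow> F \<subseteq> carrier G \<Longrightarrow> f (g <# F) \<le> f F"
begin

section \<open>Counting and quasi-tilings for subadditive functions\<close>

lemma f_nonneg: "finite F \<Longrightarrow> F \<subseteq> carrier G \<Longrightarrow> 0 \<le> f F"
  using f_mono[of "{}" F] f_empty by simp

lemma f_le_card: "finite F \<Longrightarrow> F \<subseteq> carrier G \<Longrightarrow> f F \<le> f {\<one>} * real (card F)"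
proof (induction F rule: finite_induct)
  case empty
  then show ?case using f_empty by simp
next
  case (insert x F)
  have "f {x} \<le> f {\<one>}" using f_left[of x "{\<one>}"] insert.prems by (simp add: l_coset_def)
  moreover have "f ({x} \<union> F) \<le> f {x} + f F" using insert by (intro f_Un) auto
  ultimately have "f (insert x F) \<le> f {\<one>} + f {\<one>} * real (card F)" using insert by simp
  then show ?case using insert.hyps by (simp add: algebra_simps)
qed

text \<open>A point \<open>c\<close> of \<open>D\<close> whose translate \<open>c <# F\<close>
  leaves \<open>D\<close> has \<open>c \<otimes> k\<close> outside \<open>D\<close> for some
  \<open>k\<close> in \<open>F\<close>, so it escapes through that \<open>k\<close>.\<close>

lemma card_le_core_plus_escape:
  assumes "finite D" "D \<subseteq> carrier G" "finite F"
  shows "card D \<le> card {c \<in> D. c <# F \<subseteq> D} + (\<Sum>k\<in>F. card (escape G D k))"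
proof -
  have "D \<subseteq> {c \<in> D. c <# F \<subseteq> D} \<union> (\<Union>k\<in>F. escape G D k)"
    unfolding l_coset_def escape_def by auto
  moreover have "finite (escape G D k)" for k using assms unfolding escape_def by simp
  ultimately have "card D \<le> card ({c \<in> D. c <# F \<subseteq> D} \<union> (\<Union>k\<in>F. escape G D k))"
    using assms by (intro card_mono) auto
  also have "\<dots> \<le> card {c \<in> D. c <# F \<subseteq> D} + card (\<Union>k\<in>F. escape G D k)" by (rule card_Un_le)
  also have "\<dots> \<le> card {c \<in> D. c <# F \<subseteq> D} + (\<Sum>k\<in>F. card (escape G D k))"
    using card_UN_le[OF assms(3)] by simp
  finally show ?thesis .
qed

text \<open>The counterpart of \<open>escape\<close>: when \<open>V\<close> is removed from a set,
  the new escapes from the remainder are points that \<open>k\<close> carries into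
  \<open>V\<close>.\<close>

definition enter :: "'a set \<Rightarrow> 'a \<Rightarrow> 'a set" where
  "enter V k = {x \<in> carrier G - V. x \<otimes> k \<in> V}"

lemma finite_enter:
  assumes "finite V" "k \<in> carrier G"
  shows "finite (enter V k)"
proof (rule finite_imageD)
  show "finite ((\<lambda>x. x \<otimes> k) ` enter V k)"
    by (rule finite_subset[OF _ assms(1)]) (auto simp: enter_def)
  show "inj_on (\<lambda>x. x \<otimes> k) (enter V k)"
    using assms(2) by (auto simp: inj_on_def enter_def)
qed

text \<open>If \<open>x \<otimes> k = c \<otimes> z\<close> with \<open>x\<close> outside the tile
  and \<open>z\<close> in \<open>F\<close>, then \<open>z\<close> escapes from \<open>F\<close>
  through \<open>inv k\<close>, and \<open>z\<close> determines \<open>x\<close>.\<close>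

lemma card_enter_coset:
  assumes "finite F" "F \<subseteq> carrier G" "c \<in> carrier G" "k \<in> carrier G"
  shows "card (enter (c <# F) k) \<le> card (escape G F (inv k))"
proof -
  have "enter (c <# F) k \<subseteq> (\<lambda>z. c \<otimes> (z \<otimes> inv k)) ` escape G F (inv k)"
  proof
    fix x assume "x \<in> enter (c <# F) k"
    then obtain z where z: "x \<in> carrier G" "x \<notin> c <# F" "z \<in> F" "x \<otimes> k = c \<otimes> z"
      unfolding enter_def l_coset_def by blast
    then have zG: "z \<in> carrier G" using assms by blast
    have x: "x = c \<otimes> (z \<otimes> inv k)"
      using z(1,4) zG assms by (simp add: inv_solve_right m_assoc[symmetric])
    then have "z \<otimes> inv k \<notin> F" using z(2) unfolding l_coset_def by blast
    then show "x \<in> (\<lambda>z. c \<otimes> (z \<otimes> inv k)) ` escape G F (inv k)"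
      using x z(3) unfolding escape_def by blast
  qed
  moreover have "finite (escape G F (inv k))" using assms(1) unfolding escape_def by simp
  ultimately show ?thesis by (rule surj_card_le[rotated])
qed

text \<open>Take \<open>V\<close> of maximal cardinality among unions of translates of \<open>F\<close> inside \<open>D\<close>, each of which
  adds at least \<open>(1 - \<epsilon>) * card F\<close> new points. Every other translate then meets \<open>V\<close> in more than
  \<open>\<epsilon> * card F\<close> points, and double counting bounds \<open>card V\<close> from below.\<close>

lemma quasi_tiling_step:
  assumes F: "finite F" "F \<noteq> {}" "F \<subseteq> carrier G" and fF: "f F \<le> \<rho> * real (card F)" and "0 \<le> \<rho>"
    and D: "finite D" "D \<subseteq> carrier G" and e: "0 < \<epsilon>" "\<epsilon> < 1"
  shows "\<exists>V \<subseteq> D. \<epsilon> * real (card {c \<in> D. c <# F \<subseteq> D}) \<le> real (card V) \<and>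
    f V \<le> \<rho> / (1 - \<epsilon>) * real (card V) \<and>
    (\<forall>k \<in> carrier G. real (card (enter V k)) \<le>
       real (card V) / ((1 - \<epsilon>) * real (card F)) * real (card (escape G F (inv k))))"
proof -
  define P where "P V \<longleftrightarrow> V \<subseteq> D \<and> f V \<le> \<rho> / (1 - \<epsilon>) * real (card V) \<and>
    (\<forall>k \<in> carrier G. real (card (enter V k)) \<le>
       real (card V) / ((1 - \<epsilon>) * real (card F)) * real (card (escape G F (inv k))))" for V
  have "P {}" unfolding P_def enter_def using f_empty by simp
  moreover have "\<forall>V. P V \<longrightarrow> card V < Suc (card D)"
    unfolding P_def less_Suc_eq_le using D(1) by (auto intro: card_mono)
  ultimately obtain V where PV: "P V" and max: "\<And>W. P W \<Longrightarrow> card W \<le> card V"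
    using ex_has_greatest_nat[of P "{}" card] by metis
  have V: "V \<subseteq> D" "finite V" "V \<subseteq> carrier G" using PV D finite_subset unfolding P_def by blast+
  let ?S = "{c \<in> D. c <# F \<subseteq> D}"
  have cF: "0 < real (card F)" using F by (simp add: card_gt_0_iff)
  have hit: "\<epsilon> * real (card F) \<le> real (card {x \<in> F. c \<otimes> x \<in> V})" if c: "c \<in> ?S" for c
  proof (rule ccontr)
    assume less: "\<not> ?thesis"
    have cG: "c \<in> carrier G" using c D by blast
    \<comment> \<open>The positions in the tile that are not yet covered. With fewer than
      \<open>\<epsilon> * card F\<close> covered positions, adding the tile keeps \<open>P\<close>
      and strictly enlarges \<open>V\<close>, against maximality.\<close>
    let ?N = "{x \<in> F. c \<otimes> x \<notin> V}"
    have "F = {x \<in> F. c \<otimes> x \<in> V} \<union> ?N" by blast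
    then have "card F = card {x \<in> F. c \<otimes> x \<in> V} + card ?N"
      using F(1) by (subst card_Un_disjoint[symmetric]) auto
    then have N: "(1 - \<epsilon>) * real (card F) \<le> real (card ?N)" using less by (simp add: algebra_simps)
    let ?W = "V \<union> (c <# F)"
    have fin: "finite (c <# F)" and sub: "c <# F \<subseteq> D" "c <# F \<subseteq> carrier G"
      using F c D(2) unfolding l_coset_def by auto
    have "?W = V \<union> (\<lambda>x. c \<otimes> x) ` ?N" unfolding l_coset_def by auto
    moreover have "card ((\<lambda>x. c \<otimes> x) ` ?N) = card ?N"
      using cG F(3) by (intro card_image inj_onI) (auto simp: subset_iff)
    ultimately have W: "card ?W = card V + card ?N"
      using V(2) F(1) by (subst \<open>?W = _\<close>, subst card_Un_disjoint) auto
    have "f ?W \<le> f V + f (c <# F)" using V fin sub by (intro f_Un) auto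
    also have "\<dots> \<le> \<rho> / (1 - \<epsilon>) * real (card V) + \<rho> * real (card F)"
      using f_left[OF cG F(1,3)] fF PV unfolding P_def by simp
    also have "\<rho> * real (card F) = \<rho> / (1 - \<epsilon>) * ((1 - \<epsilon>) * real (card F))" using e by simp
    also have "\<dots> \<le> \<rho> / (1 - \<epsilon>) * real (card ?N)"
      using N e \<open>0 \<le> \<rho>\<close> by (intro mult_left_mono) auto
    finally have fW: "f ?W \<le> \<rho> / (1 - \<epsilon>) * real (card ?W)" unfolding W by (simp add: algebra_simps)
    have "real (card (enter ?W k)) \<le>
       real (card ?W) / ((1 - \<epsilon>) * real (card F)) * real (card (escape G F (inv k)))"
      if k: "k \<in> carrier G" for k
    proof -
      let ?q = "real (card (escape G F (inv k)))"
      have "enter ?W k \<subseteq> enter V k \<union> enter (c <# F) k" unfolding enter_def by blast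
      then have "card (enter ?W k) \<le> card (enter V k \<union> enter (c <# F) k)"
        using finite_enter V fin k by (intro card_mono) auto
      also have "\<dots> \<le> card (enter V k) + card (enter (c <# F) k)" by (rule card_Un_le)
      also have "\<dots> \<le> card (enter V k) + card (escape G F (inv k))"
        using card_enter_coset[OF F(1,3) cG k] by simp
      finally have "real (card (enter ?W k)) \<le> real (card (enter V k)) + ?q" by linarith
      also have "\<dots> \<le> real (card V) / ((1 - \<epsilon>) * real (card F)) * ?q + 1 * ?q"
        using PV k unfolding P_def by simp
      also have "\<dots> \<le> real (card V) / ((1 - \<epsilon>) * real (card F)) * ?q
          + real (card ?N) / ((1 - \<epsilon>) * real (card F)) * ?q"
        using N e cF by (intro add_left_mono mult_right_mono) (auto simp: le_divide_eq)
      also have "\<dots> = real (card ?W) / ((1 - \<epsilon>) * real (card F)) * ?q"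
        unfolding W by (simp add: add_divide_distrib algebra_simps)
      finally show ?thesis .
    qed
    then have "P ?W" using fW V(1) sub(1) unfolding P_def by blast
    then have "card ?N = 0" using max[of ?W] W by simp
    moreover have "0 < (1 - \<epsilon>) * real (card F)" using e cF by simp
    ultimately show False using N by linarith
  qed
  \<comment> \<open>Double counting of the pairs \<open>(c, x)\<close> with
    \<open>c \<otimes> x\<close> in \<open>V\<close>: each \<open>c\<close> contributes at least
    \<open>\<epsilon> * card F\<close> of them, while a pair is determined by
    \<open>c \<otimes> x\<close> and \<open>x\<close>.\<close>
  have "real (card F) * (\<epsilon> * real (card ?S)) = (\<Sum>c\<in>?S. \<epsilon> * real (card F))" by simp
  also have "\<dots> \<le> (\<Sum>c\<in>?S. real (card {x \<in> F. c \<otimes> x \<in> V}))" by (rule sum_mono) (rule hit)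
  also have "\<dots> = real (card (SIGMA c:?S. {x \<in> F. c \<otimes> x \<in> V}))"
    using D F by (subst card_SigmaI) auto
  also have "\<dots> \<le> real (card (V \<times> F))"
  proof -
    have "inj_on (\<lambda>(c, x). (c \<otimes> x, x)) (SIGMA c:?S. {x \<in> F. c \<otimes> x \<in> V})"
      using D(2) F(3) by (auto simp: inj_on_def subset_iff)
    moreover have "(\<lambda>(c, x). (c \<otimes> x, x)) ` (SIGMA c:?S. {x \<in> F. c \<otimes> x \<in> V}) \<subseteq> V \<times> F" by auto
    ultimately show ?thesis
      using card_inj_on_le[OF _ _ finite_cartesian_product[OF V(2) F(1)]] by (simp only: of_nat_le_iff)
  qed
  also have "\<dots> = real (card F) * real (card V)" by (simp add: card_cartesian_product)
  finally have "\<epsilon> * real (card ?S) \<le> real (card V)" using cF by simp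
  then show ?thesis using PV unfolding P_def by blast
qed

text \<open>One round of quasi-tiling with \<open>\<epsilon> = 1 - \<tau>\<close> is enough: the
  tiles may overlap heavily, which costs a factor \<open>1 / \<tau>\<close>, but the ratio
  \<open>\<tau> ^ 2\<close> absorbs it, and at most a proportion \<open>2 * \<tau>\<close> stays
  uncovered.\<close>

lemma almost_zero_of_small_ratio:
  assumes small: "\<And>\<epsilon>. 0 < \<epsilon> \<Longrightarrow>
      \<exists>F. finite F \<and> F \<noteq> {} \<and> F \<subseteq> carrier G \<and> f F \<le> \<epsilon> * real (card F)"
    and "0 < \<eta>"
  shows "\<exists>K \<delta>. finite K \<and> K \<subseteq> carrier G \<and> 0 < \<delta> \<and>
    (\<forall>D. almost_inv G K \<delta> D \<longrightarrow> f D \<le> \<eta> * real (card D))"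
proof -
  define L where "L = f {\<one>}"
  have L: "0 \<le> L" unfolding L_def by (rule f_nonneg) auto
  \<comment> \<open>Per point of \<open>D\<close>, the covered part will cost \<open>\<tau>\<close>
    and the uncovered part \<open>2 * \<tau> * L\<close>; the choice keeps the sum below or equal to
    \<open>\<eta>\<close>.\<close>
  define \<tau> where "\<tau> = min (1/2) (\<eta> / (1 + 2 * L))"
  have \<tau>: "0 < \<tau>" "\<tau> < 1" using L \<open>0 < \<eta>\<close> unfolding \<tau>_def by auto
  have "\<tau> \<le> \<eta> / (1 + 2 * L)" unfolding \<tau>_def by simp
  then have \<tau>': "\<tau> * (1 + 2 * L) \<le> \<eta>" using L by (simp add: le_divide_eq split: if_splits)
  obtain F where F: "finite F" "F \<noteq> {}" "F \<subseteq> carrier G" "f F \<le> \<tau> ^ 2 * real (card F)"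
    using small[of "\<tau> ^ 2"] \<tau> by auto
  have cF: "0 < real (card F)" using F by (simp add: card_gt_0_iff)
  have "f D \<le> \<eta> * real (card D)" if inv: "almost_inv G F (\<tau> / real (card F)) D" for D
  proof -
    have D: "finite D" "D \<subseteq> carrier G" using inv unfolding almost_inv_def by auto
    have "(\<Sum>k\<in>F. real (card (escape G D k))) \<le> (\<Sum>k\<in>F. \<tau> / real (card F) * real (card D))"
      using inv unfolding almost_inv_def by (intro sum_mono) auto
    then have esc: "(\<Sum>k\<in>F. real (card (escape G D k))) \<le> \<tau> * real (card D)" using cF by simp
    have S: "real (card D) \<le> real (card {c \<in> D. c <# F \<subseteq> D}) + \<tau> * real (card D)"
      using card_le_core_plus_escape[OF D F(1)] esc by (simp flip: of_nat_sum)
    obtain V where V: "V \<subseteq> D" "(1 - \<tau>) * real (card {c \<in> D. c <# F \<subseteq> D}) \<le> real (card V)"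
      "f V \<le> \<tau> ^ 2 / (1 - (1 - \<tau>)) * real (card V)"
      using quasi_tiling_step[OF F(1-4) _ D, of "1 - \<tau>"] \<tau> by auto
    have DV: "real (card (D - V)) = real (card D) - real (card V)"
      using V(1) D(1) by (simp add: card_Diff_subset finite_subset card_mono of_nat_diff)
    have "(1 - \<tau>) * (real (card D) - \<tau> * real (card D)) \<le> (1 - \<tau>) * real (card {c \<in> D. c <# F \<subseteq> D})"
      using S \<tau> by (intro mult_left_mono) auto
    then have "(1 - \<tau>) * (real (card D) - \<tau> * real (card D)) \<le> real (card V)" using V(2) by linarith
    moreover have "(1 - \<tau>) * (real (card D) - \<tau> * real (card D)) =
        real (card D) - 2 * \<tau> * real (card D) + \<tau> * (\<tau> * real (card D))"
      by (simp add: algebra_simps)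
    moreover have "0 \<le> \<tau> * (\<tau> * real (card D))" using \<tau> by simp
    ultimately have DV': "real (card (D - V)) \<le> 2 * \<tau> * real (card D)" using DV by linarith
    have "f D = f (V \<union> (D - V))" using V(1) by (simp add: Un_absorb1)
    also have "\<dots> \<le> f V + f (D - V)" using V(1) D finite_subset by (intro f_Un) auto
    also have "f V \<le> \<tau> * real (card V)" using V(3) \<tau>(1) by (simp add: power2_eq_square)
    also have "\<dots> \<le> \<tau> * real (card D)" using V(1) D(1) \<tau> by (simp add: card_mono)
    also have "f (D - V) \<le> L * real (card (D - V))" unfolding L_def using D by (intro f_le_card) auto
    also have "\<dots> \<le> L * (2 * \<tau> * real (card D))" using DV' L by (rule mult_left_mono)
    also have "\<tau> * real (card D) + L * (2 * \<tau> * real (card D)) = \<tau> * (1 + 2 * L) * real (card D)"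
      by (simp add: algebra_simps)
    also have "\<dots> \<le> \<eta> * real (card D)" using \<tau>' by (rule mult_right_mono) simp
    finally show ?thesis by simp
  qed
  then show ?thesis
    using F(1,3) cF \<tau>(1) by (intro exI[of _ F] exI[of _ "\<tau> / real (card F)"] conjI allI impI) auto
qed

text \<open>The infimum of the non-negative \<open>\<rho>\<close> with this property will be the
  limit. Arbitrary invariance is demanded so that tiles of these shapes leave an almost invariant
  remainder.\<close>

definition ratio_bound :: "real \<Rightarrow> bool" where
  "ratio_bound \<rho> \<longleftrightarrow> (\<forall>K \<delta>. finite K \<longrightarrow> K \<subseteq> carrier G \<longrightarrow> 0 < \<delta> \<longrightarrow>
     (\<exists>F. almost_inv G K \<delta> F \<and> f F \<le> \<rho> * real (card F)))"

text \<open>The induction invariant: \<open>C\<close> bounds the cost per covered point and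
  \<open>\<theta>\<close> the uncovered proportion. Invariance of the remainder is measured against
  \<open>card D\<close>, since the remainder itself may be very small or empty.\<close>

definition tileable :: "real \<Rightarrow> real \<Rightarrow> bool" where
  "tileable C \<theta> \<longleftrightarrow> (\<forall>K \<delta>. finite K \<longrightarrow> K \<subseteq> carrier G \<longrightarrow> 0 < \<delta> \<longrightarrow>
     (\<exists>L \<gamma>. finite L \<and> L \<subseteq> carrier G \<and> 0 < \<gamma> \<and> (\<forall>D. almost_inv G L \<gamma> D \<longrightarrow>
       (\<exists>V \<subseteq> D. real (card (D - V)) \<le> \<theta> * real (card D) \<and> f V \<le> C * real (card V) \<and>
          (\<forall>k\<in>K. real (card (escape G (D - V) k)) \<le> \<delta> * real (card D))))))"

lemma tileable_one: "tileable C 1"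
  unfolding tileable_def
proof (intro allI impI)
  fix K :: "'a set" and \<delta> :: real assume *: "finite K" "K \<subseteq> carrier G" "0 < \<delta>"
  show "\<exists>L \<gamma>. finite L \<and> L \<subseteq> carrier G \<and> 0 < \<gamma> \<and> (\<forall>D. almost_inv G L \<gamma> D \<longrightarrow>
       (\<exists>V \<subseteq> D. real (card (D - V)) \<le> 1 * real (card D) \<and> f V \<le> C * real (card V) \<and>
          (\<forall>k\<in>K. real (card (escape G (D - V) k)) \<le> \<delta> * real (card D))))"
    using * f_empty
    by (intro exI[of _ K] exI[of _ \<delta>] conjI allI impI exI[of _ "{}"]) (auto simp: almost_inv_def)
qed

text \<open>The largest shapes are placed first: the tiles already placed are almost invariant under the
  next shape \<open>F\<close>, so the remainder stays almost invariant and a further fraction of it can be tiled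
  by translates of \<open>F\<close>.\<close>

lemma tileable_step:
  assumes rb: "ratio_bound \<rho>" and "0 \<le> \<rho>" and e: "0 < \<epsilon>" "\<epsilon> < 1" and "0 < \<theta>"
    and tile: "tileable (\<rho> / (1 - \<epsilon>)) \<theta>"
  shows "tileable (\<rho> / (1 - \<epsilon>)) ((1 - \<epsilon> / 2) * \<theta>)"
  unfolding tileable_def
proof (intro allI impI)
  fix K :: "'a set" and \<delta> :: real assume K: "finite K" "K \<subseteq> carrier G" and "0 < \<delta>"
  \<comment> \<open>Entering a tile through \<open>k\<close> corresponds to escaping from
    \<open>F\<close> through \<open>inv k\<close>, hence the inverses of \<open>K\<close>. With this
    tolerance the entries into the new tiles use at most half of \<open>\<delta>\<close>.\<close>
  have "0 < (1 - \<epsilon>) * \<delta> / 2" using e \<open>0 < \<delta>\<close> by simp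
  moreover have "finite (m_inv G ` K)" "m_inv G ` K \<subseteq> carrier G" using K by auto
  ultimately obtain F where F': "almost_inv G (m_inv G ` K) ((1 - \<epsilon>) * \<delta> / 2) F"
    and fF: "f F \<le> \<rho> * real (card F)"
    using rb unfolding ratio_bound_def by blast
  then have F: "finite F" "F \<noteq> {}" "F \<subseteq> carrier G" unfolding almost_inv_def by auto
  have cF: "0 < real (card F)" using F by (simp add: card_gt_0_iff)
  \<comment> \<open>The first bound leaves half of \<open>\<delta>\<close> for the new tiles. The
    second limits the points of the remainder at which no translate of \<open>F\<close> fits to at
    most \<open>\<theta> / 2\<close> per point of \<open>D\<close>.\<close>
  define \<delta>' where "\<delta>' = min (\<delta> / 2) (\<theta> / (2 * real (card F)))"
  have \<delta>': "0 < \<delta>'" "\<delta>' \<le> \<delta> / 2" "real (card F) * \<delta>' \<le> \<theta> / 2"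
    using cF \<open>0 < \<delta>\<close> \<open>0 < \<theta>\<close> unfolding \<delta>'_def by (auto simp: min_def field_simps)
  obtain L \<gamma> where L: "finite L" "L \<subseteq> carrier G" "0 < \<gamma>"
    and LD: "\<And>D. almost_inv G L \<gamma> D \<Longrightarrow>
       \<exists>V \<subseteq> D. real (card (D - V)) \<le> \<theta> * real (card D) \<and> f V \<le> \<rho> / (1 - \<epsilon>) * real (card V) \<and>
          (\<forall>k\<in>K \<union> F. real (card (escape G (D - V) k)) \<le> \<delta>' * real (card D))"
    using tile[unfolded tileable_def, rule_format, of "K \<union> F" \<delta>'] K F \<delta>' by auto
  have "\<exists>V \<subseteq> D. real (card (D - V)) \<le> (1 - \<epsilon> / 2) * \<theta> * real (card D) \<and>
      f V \<le> \<rho> / (1 - \<epsilon>) * real (card V) \<and>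
      (\<forall>k\<in>K. real (card (escape G (D - V) k)) \<le> \<delta> * real (card D))"
    if D': "almost_inv G L \<gamma> D" for D
  proof -
    let ?d = "real (card D)"
    have D: "finite D" "D \<subseteq> carrier G" using D' unfolding almost_inv_def by auto
    obtain V where V: "V \<subseteq> D" "real (card (D - V)) \<le> \<theta> * ?d" "f V \<le> \<rho> / (1 - \<epsilon>) * real (card V)"
      "\<And>k. k \<in> K \<union> F \<Longrightarrow> real (card (escape G (D - V) k)) \<le> \<delta>' * ?d"
      using LD[OF D'] by blast
    define R where "R = D - V"
    have R: "finite R" "R \<subseteq> carrier G" using D unfolding R_def by auto
    obtain W where W: "W \<subseteq> R" "\<epsilon> * real (card {c \<in> R. c <# F \<subseteq> R}) \<le> real (card W)"
      "f W \<le> \<rho> / (1 - \<epsilon>) * real (card W)"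
      "\<And>k. k \<in> carrier G \<Longrightarrow> real (card (enter W k)) \<le>
         real (card W) / ((1 - \<epsilon>) * real (card F)) * real (card (escape G F (inv k)))"
      using quasi_tiling_step[OF F fF \<open>0 \<le> \<rho>\<close> R e] by blast
    have fin: "finite V" "finite W" using V(1) W(1) D(1) R(1) finite_subset by auto
    have subG: "V \<subseteq> carrier G" "W \<subseteq> carrier G" using V(1) W(1) D(2) R(2) by auto
    have disj: "V \<inter> W = {}" using W(1) unfolding R_def by blast
    have eqR: "D - (V \<union> W) = R - W" unfolding R_def by blast
    have "(\<Sum>k\<in>F. real (card (escape G R k))) \<le> (\<Sum>k\<in>F. \<delta>' * ?d)"
      using V(4) unfolding R_def by (intro sum_mono) auto
    also have "\<dots> = real (card F) * \<delta>' * ?d" by simp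
    also have "\<dots> \<le> \<theta> / 2 * ?d" using \<delta>'(3) by (rule mult_right_mono) simp
    finally have "real (card R) \<le> real (card {c \<in> R. c <# F \<subseteq> R}) + \<theta> / 2 * ?d"
      using card_le_core_plus_escape[OF R F(1)] by (simp flip: of_nat_sum)
    then have "\<epsilon> * (real (card R) - \<theta> / 2 * ?d) \<le> \<epsilon> * real (card {c \<in> R. c <# F \<subseteq> R})"
      using e by (intro mult_left_mono) auto
    then have "\<epsilon> * (real (card R) - \<theta> / 2 * ?d) \<le> real (card W)" using W(2) by linarith
    moreover have "real (card (R - W)) = real (card R) - real (card W)"
      using W(1) R(1) by (simp add: card_Diff_subset finite_subset card_mono of_nat_diff)
    ultimately have "real (card (R - W)) \<le> (1 - \<epsilon>) * real (card R) + \<epsilon> * (\<theta> / 2 * ?d)"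
      by (simp add: algebra_simps)
    \<comment> \<open>The boundary loss \<open>\<theta> / 2\<close> halves the gain of the round,
      which explains the factor \<open>1 - \<epsilon> / 2\<close>.\<close>
    also have "\<dots> \<le> (1 - \<epsilon>) * (\<theta> * ?d) + \<epsilon> * (\<theta> / 2 * ?d)"
      using V(2) e unfolding R_def by (intro add_right_mono mult_left_mono) auto
    also have "\<dots> = (1 - \<epsilon> / 2) * \<theta> * ?d" by (simp add: algebra_simps)
    finally have 1: "real (card (D - (V \<union> W))) \<le> (1 - \<epsilon> / 2) * \<theta> * ?d" unfolding eqR .
    have "f (V \<union> W) \<le> f V + f W" using fin subG by (intro f_Un) auto
    also have "\<dots> \<le> \<rho> / (1 - \<epsilon>) * (real (card V) + real (card W))"
      using V(3) W(3) by (simp add: distrib_left)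
    also have "real (card V) + real (card W) = real (card (V \<union> W))"
      using fin disj by (simp add: card_Un_disjoint)
    finally have 2: "f (V \<union> W) \<le> \<rho> / (1 - \<epsilon>) * real (card (V \<union> W))" .
    have 3: "real (card (escape G (D - (V \<union> W)) k)) \<le> \<delta> * ?d" if k: "k \<in> K" for k
    proof -
      have kG: "k \<in> carrier G" using k K by blast
      have "real (card (enter W k)) \<le>
          real (card W) / ((1 - \<epsilon>) * real (card F)) * ((1 - \<epsilon>) * \<delta> / 2 * real (card F))"
      proof -
        have "real (card (escape G F (inv k))) \<le> (1 - \<epsilon>) * \<delta> / 2 * real (card F)"
          using F' k unfolding almost_inv_def by blast
        then have "real (card W) / ((1 - \<epsilon>) * real (card F)) * real (card (escape G F (inv k)))
            \<le> real (card W) / ((1 - \<epsilon>) * real (card F)) * ((1 - \<epsilon>) * \<delta> / 2 * real (card F))"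
          using e cF by (intro mult_left_mono) auto
        then show ?thesis using W(4)[OF kG] by linarith
      qed
      also have "\<dots> = \<delta> / 2 * real (card W)" using e cF by (simp add: field_simps)
      also have "\<dots> \<le> \<delta> / 2 * ?d"
        using W(1) \<open>0 < \<delta>\<close> D(1) unfolding R_def by (intro mult_left_mono) (auto intro: card_mono)
      finally have ent: "real (card (enter W k)) \<le> \<delta> / 2 * ?d" .
      have "escape G (R - W) k \<subseteq> escape G R k \<union> enter W k"
        using R(2) unfolding escape_def enter_def by blast
      then have "card (escape G (R - W) k) \<le> card (escape G R k \<union> enter W k)"
        using R(1) finite_enter[OF fin(2) kG] by (intro card_mono) (auto simp: escape_def)
      also have "\<dots> \<le> card (escape G R k) + card (enter W k)" by (rule card_Un_le)
      finally have "real (card (escape G (R - W) k)) \<le> \<delta>' * ?d + \<delta> / 2 * ?d"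
        using V(4)[of k] k ent unfolding R_def by simp
      also have "\<dots> \<le> \<delta> / 2 * ?d + \<delta> / 2 * ?d"
        using \<delta>'(2) by (intro add_right_mono mult_right_mono) auto
      finally show ?thesis unfolding eqR by simp
    qed
    have "V \<union> W \<subseteq> D" using V(1) W(1) unfolding R_def by blast
    then show ?thesis using 1 2 3 by blast
  qed
  then show "\<exists>L \<gamma>. finite L \<and> L \<subseteq> carrier G \<and> 0 < \<gamma> \<and> (\<forall>D. almost_inv G L \<gamma> D \<longrightarrow>
       (\<exists>V \<subseteq> D. real (card (D - V)) \<le> (1 - \<epsilon> / 2) * \<theta> * real (card D) \<and>
          f V \<le> \<rho> / (1 - \<epsilon>) * real (card V) \<and>
          (\<forall>k\<in>K. real (card (escape G (D - V) k)) \<le> \<delta> * real (card D))))"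
    using L by blast
qed

text \<open>Passes from some almost invariant sets to all sufficiently invariant ones: tiling rounds
  are repeated until the uncovered proportion \<open>(1 - \<epsilon> / 2) ^ n\<close> is so small
  that the trivial bound \<open>f {\<one>}\<close> per point costs at most
  \<open>\<eta> / 2\<close>.\<close>

lemma ratio_bound_eventually:
  assumes rb: "ratio_bound \<rho>" and "0 \<le> \<rho>" and "0 < \<eta>"
  shows "\<exists>K \<delta>. finite K \<and> K \<subseteq> carrier G \<and> 0 < \<delta> \<and>
    (\<forall>D. almost_inv G K \<delta> D \<longrightarrow> f D \<le> (\<rho> + \<eta>) * real (card D))"
proof -
  \<comment> \<open>Chosen so that the overlap factor \<open>1 / (1 - \<epsilon>)\<close> raises
    \<open>\<rho>\<close> to at most \<open>\<rho> + \<eta> / 2\<close>.\<close>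
  define \<epsilon> where "\<epsilon> = \<eta> / (2 * (\<rho> + \<eta>))"
  have e: "0 < \<epsilon>" "\<epsilon> < 1" using \<open>0 \<le> \<rho>\<close> \<open>0 < \<eta>\<close> unfolding \<epsilon>_def by (auto simp: field_simps)
  have "\<rho> \<le> (\<rho> + \<eta> / 2) * (1 - \<epsilon>)"
  proof -
    have "(\<rho> + \<eta> / 2) * \<epsilon> \<le> (\<rho> + \<eta>) * \<epsilon>" using e \<open>0 < \<eta>\<close> by (intro mult_right_mono) auto
    also have "\<dots> = \<eta> / 2" unfolding \<epsilon>_def using \<open>0 \<le> \<rho>\<close> \<open>0 < \<eta>\<close> by (simp add: field_simps)
    finally show ?thesis by (simp add: algebra_simps)
  qed
  then have C: "\<rho> / (1 - \<epsilon>) \<le> \<rho> + \<eta> / 2" using e by (simp add: divide_le_eq)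
  have tile: "tileable (\<rho> / (1 - \<epsilon>)) ((1 - \<epsilon> / 2) ^ n)" for n
  proof (induction n)
    case 0
    show ?case using tileable_one by simp
  next
    case (Suc n)
    then show ?case using tileable_step[OF rb \<open>0 \<le> \<rho>\<close> e] e by simp
  qed
  define M where "M = f {\<one>}"
  have M: "0 \<le> M" unfolding M_def by (rule f_nonneg) auto
  have "0 < \<eta> / (2 * (M + 1))" using M \<open>0 < \<eta>\<close> by simp
  then obtain n where n: "(1 - \<epsilon> / 2) ^ n < \<eta> / (2 * (M + 1))"
    using real_arch_pow_inv[of _ "1 - \<epsilon> / 2"] e by auto
  have "M * (1 - \<epsilon> / 2) ^ n \<le> (M + 1) * (\<eta> / (2 * (M + 1)))"
    using n M e by (intro mult_mono) auto
  also have "\<dots> = \<eta> / 2" using M by (simp add: field_simps)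
  finally have Mn: "M * (1 - \<epsilon> / 2) ^ n \<le> \<eta> / 2" .
  obtain K \<delta> where K: "finite K" "K \<subseteq> carrier G" "0 < \<delta>"
    and KD: "\<And>D. almost_inv G K \<delta> D \<Longrightarrow> \<exists>V \<subseteq> D. real (card (D - V)) \<le> (1 - \<epsilon> / 2) ^ n * real (card D) \<and>
      f V \<le> \<rho> / (1 - \<epsilon>) * real (card V)"
    using tile[of n, unfolded tileable_def, rule_format, of "{}" 1] by auto
  have "f D \<le> (\<rho> + \<eta>) * real (card D)" if inv: "almost_inv G K \<delta> D" for D
  proof -
    have D: "finite D" "D \<subseteq> carrier G" using inv unfolding almost_inv_def by auto
    obtain V where V: "V \<subseteq> D" "real (card (D - V)) \<le> (1 - \<epsilon> / 2) ^ n * real (card D)"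
      "f V \<le> \<rho> / (1 - \<epsilon>) * real (card V)" using KD[OF inv] by blast
    have "f D = f (V \<union> (D - V))" using V(1) by (simp add: Un_absorb1)
    also have "\<dots> \<le> f V + f (D - V)" using V(1) D finite_subset by (intro f_Un) auto
    also have "f V \<le> (\<rho> + \<eta> / 2) * real (card D)"
    proof -
      have "\<rho> / (1 - \<epsilon>) * real (card V) \<le> (\<rho> + \<eta> / 2) * real (card D)"
        using C V(1) D(1) \<open>0 \<le> \<rho>\<close> \<open>0 < \<eta>\<close> by (intro mult_mono) (auto intro: card_mono)
      then show ?thesis using V(3) by linarith
    qed
    also have "f (D - V) \<le> M * real (card (D - V))" unfolding M_def using D by (intro f_le_card) auto
    also have "\<dots> \<le> M * ((1 - \<epsilon> / 2) ^ n * real (card D))" using V(2) M by (rule mult_left_mono)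
    also have "\<dots> \<le> \<eta> / 2 * real (card D)"
      using mult_right_mono[OF Mn, of "real (card D)"] by (simp add: mult.assoc)
    finally show ?thesis by (simp add: algebra_simps)
  qed
  then show ?thesis using K by blast
qed

text \<open>The limit is the infimum \<open>h\<close> of the ratios that arbitrarily invariant sets
  can achieve. Values slightly above \<open>h\<close> bound all sufficiently invariant sets; a
  non-negative value below \<open>h\<close> fails \<open>ratio_bound\<close>, so all sufficiently
  invariant sets exceed it.\<close>

lemma ornstein_weiss:
  assumes "folner_condition G"
  obtains h where "\<And>(I :: 'i filter) D. right_folner_net G I D \<Longrightarrow>
    ((\<lambda>i. f (D i) / real (card (D i))) \<longlongrightarrow> h) I"
proof -
  define \<Lambda> where "\<Lambda> = {\<rho>. 0 \<le> \<rho> \<and> ratio_bound \<rho>}"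
  define h where "h = Inf \<Lambda>"
  have "f {\<one>} \<in> \<Lambda>"
  proof -
    have "f F \<le> f {\<one>} * real (card F)" if "almost_inv G K \<delta> F" for K \<delta> F
      using that unfolding almost_inv_def by (intro f_le_card) auto
    then have "ratio_bound (f {\<one>})"
      using assms unfolding ratio_bound_def folner_condition_def by metis
    then show ?thesis using f_nonneg[of "{\<one>}"] unfolding \<Lambda>_def by simp
  qed
  then have ne: "\<Lambda> \<noteq> {}" by blast
  have bdd: "bdd_below \<Lambda>" unfolding \<Lambda>_def by (rule bdd_belowI[of _ 0]) blast
  have h0: "0 \<le> h" unfolding h_def using ne by (rule cInf_greatest) (simp add: \<Lambda>_def)
  show thesis
  proof (rule that[of h], rule tendstoI)
    fix I :: "'i filter" and D and e :: real
    assume net: "right_folner_net G I D" and "0 < e"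
    obtain \<rho> where \<rho>: "\<rho> \<in> \<Lambda>" "\<rho> < h + e / 2"
      using cInf_lessD[OF ne, of "h + e / 2"] \<open>0 < e\<close> unfolding h_def by auto
    obtain K \<delta> where "finite K" "K \<subseteq> carrier G" "0 < \<delta>"
      and K: "\<And>E. almost_inv G K \<delta> E \<Longrightarrow> f E \<le> (\<rho> + e / 2) * real (card E)"
      using ratio_bound_eventually[of \<rho> "e / 2"] \<rho>(1) \<open>0 < e\<close> unfolding \<Lambda>_def by auto
    then have upper: "\<forall>\<^sub>F i in I. almost_inv G K \<delta> (D i)"
      using right_folner_net_almost_inv[OF net] by blast
    have lower: "\<forall>\<^sub>F i in I. (h - e / 2) * real (card (D i)) \<le> f (D i) \<and> almost_inv G K \<delta> (D i)"
    proof (cases "0 \<le> h - e / 2")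
      case True
      have "h - e / 2 \<notin> \<Lambda>" using cInf_lower[OF _ bdd, of "h - e / 2"] \<open>0 < e\<close> unfolding h_def by auto
      then have "\<not> ratio_bound (h - e / 2)" using True unfolding \<Lambda>_def by simp
      then obtain L \<gamma> where L: "finite L" "L \<subseteq> carrier G" "0 < \<gamma>"
        and lo: "\<And>E. almost_inv G L \<gamma> E \<Longrightarrow> \<not> f E \<le> (h - e / 2) * real (card E)"
        unfolding ratio_bound_def by blast
      show ?thesis
        using right_folner_net_almost_inv[OF net L] upper by eventually_elim (use lo in force)
    next
      case False
      \<comment> \<open>A negative \<open>h - e / 2\<close> lies outside \<open>\<Lambda>\<close> by
        its sign alone, so the lower bound comes from non-negativity of \<open>f\<close>
        instead.\<close>
      show ?thesis
        using upper
      proof eventually_elim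
        case (elim i)
        then have "0 \<le> f (D i)" unfolding almost_inv_def by (intro f_nonneg) auto
        moreover have "(h - e / 2) * real (card (D i)) \<le> 0" using False by (simp add: mult_nonpos_nonneg)
        ultimately show ?case using elim by linarith
      qed
    qed
    show "\<forall>\<^sub>F i in I. dist (f (D i) / real (card (D i))) h < e"
      using lower
    proof eventually_elim
      case (elim i)
      then have c: "0 < real (card (D i))" unfolding almost_inv_def by (simp add: card_gt_0_iff)
      have "f (D i) \<le> (\<rho> + e / 2) * real (card (D i))" using K elim by blast
      then have "f (D i) / real (card (D i)) \<le> \<rho> + e / 2" "h - e / 2 \<le> f (D i) / real (card (D i))"
        using c elim by (auto simp: divide_le_eq le_divide_eq)
      then show ?case using \<rho>(2) \<open>0 < e\<close> by (simp add: dist_real_def abs_less_iff)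
    qed
  qed
qed

end

section \<open>Trajectories and entropy\<close>

lemma (in group) card_set_mult_le:
  assumes "finite U" "finite V"
  shows "card (U <#> V) \<le> card U * card V"
proof -
  have "U <#> V = (\<lambda>(u, v). u \<otimes> v) ` (U \<times> V)" unfolding set_mult_def by auto
  then show ?thesis using card_image_le[of "U \<times> V"] assms by (simp add: card_cartesian_product)
qed

lemma (in group) card_le_card_set_mult:
  assumes "finite U" "finite V" "V \<noteq> {}" "U \<subseteq> carrier G" "V \<subseteq> carrier G"
  shows "card U \<le> card (U <#> V)"
proof -
  obtain v where v: "v \<in> V" using assms(3) by blast
  have "inj_on (\<lambda>u. u \<otimes> v) U" using v assms by (auto simp: inj_on_def subset_iff)
  moreover have "(\<lambda>u. u \<otimes> v) ` U \<subseteq> U <#> V" using v unfolding set_mult_def by auto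
  moreover have "finite (U <#> V)" using assms unfolding set_mult_def by auto
  ultimately show ?thesis by (rule card_inj_on_le)
qed

locale abelian_action = group G + A: comm_group A
  for G :: "('g, 'm) monoid_scheme" (structure) and A :: "('a, 'n) monoid_scheme" +
  fixes \<alpha> :: "'g \<Rightarrow> 'a \<Rightarrow> 'a"
  assumes action: "left_action G A \<alpha>"
begin

lemma action_hom: "g \<in> carrier G \<Longrightarrow> \<alpha> g \<in> hom A A"
  and action_mult: "g \<in> carrier G \<Longrightarrow> h \<in> carrier G \<Longrightarrow> x \<in> carrier A \<Longrightarrow> \<alpha> (g \<otimes> h) x = \<alpha> g (\<alpha> h x)"
  using action unfolding left_action_def by auto

lemma action_image_subset: "g \<in> carrier G \<Longrightarrow> X \<subseteq> carrier A \<Longrightarrow> \<alpha> g ` X \<subseteq> carrier A"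
  using hom_in_carrier[OF action_hom] by blast

lemma trajectory_empty: "trajectory A \<alpha> {} X = {\<one>\<^bsub>A\<^esub>}"
  unfolding trajectory_def by auto

lemma trajectory_singleton:
  assumes "g \<in> carrier G" "X \<subseteq> carrier A"
  shows "trajectory A \<alpha> {g} X = \<alpha> g ` X"
proof -
  have fp: "finprod A y {g} = y g" if "y g \<in> \<alpha> g ` X" for y
    using A.finprod_insert[of "{}" g y] that action_image_subset[OF assms] by (simp add: subset_iff)
  have "z \<in> trajectory A \<alpha> {g} X" if "z \<in> \<alpha> g ` X" for z
    using fp[of "\<lambda>_. z"] that unfolding trajectory_def by (auto intro!: exI[of _ "\<lambda>_. z"])
  moreover have "z \<in> \<alpha> g ` X" if "z \<in> trajectory A \<alpha> {g} X" for z
    using that fp unfolding trajectory_def by auto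
  ultimately show ?thesis by blast
qed

lemma trajectory_Un:
  assumes fin: "finite E" "finite F" and disj: "E \<inter> F = {}"
    and sub: "E \<subseteq> carrier G" "F \<subseteq> carrier G" and X: "X \<subseteq> carrier A"
  shows "trajectory A \<alpha> (E \<union> F) X = trajectory A \<alpha> E X <#>\<^bsub>A\<^esub> trajectory A \<alpha> F X"
proof -
  have val: "y \<in> S \<rightarrow> carrier A" if "\<forall>g\<in>S. y g \<in> \<alpha> g ` X" "S \<subseteq> carrier G" for y S
    using that action_image_subset[OF _ X] by blast
  show ?thesis
  proof (intro equalityI subsetI)
    fix z assume "z \<in> trajectory A \<alpha> (E \<union> F) X"
    then obtain y where y: "z = finprod A y (E \<union> F)" "\<forall>g\<in>E \<union> F. y g \<in> \<alpha> g ` X"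
      unfolding trajectory_def by blast
    then have "z = finprod A y E \<otimes>\<^bsub>A\<^esub> finprod A y F"
      using A.finprod_Un_disjoint[OF fin disj] val[of _ y] sub by simp
    then show "z \<in> trajectory A \<alpha> E X <#>\<^bsub>A\<^esub> trajectory A \<alpha> F X"
      using y(2) unfolding trajectory_def set_mult_def by blast
  next
    fix z assume "z \<in> trajectory A \<alpha> E X <#>\<^bsub>A\<^esub> trajectory A \<alpha> F X"
    then obtain u v where uv: "z = finprod A u E \<otimes>\<^bsub>A\<^esub> finprod A v F"
      "\<forall>g\<in>E. u g \<in> \<alpha> g ` X" "\<forall>g\<in>F. v g \<in> \<alpha> g ` X"
      unfolding trajectory_def set_mult_def by blast
    define y where "y g = (if g \<in> E then u g else v g)" for g
    have y: "\<forall>g\<in>E \<union> F. y g \<in> \<alpha> g ` X" using uv unfolding y_def by auto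
    have uE: "u \<in> E \<rightarrow> carrier A" and vF: "v \<in> F \<rightarrow> carrier A" using val uv sub by auto
    have "finprod A y E = finprod A u E"
      using uE by (intro A.finprod_cong') (auto simp: y_def)
    moreover have "finprod A y F = finprod A v F"
      using vF disj by (intro A.finprod_cong') (auto simp: y_def)
    ultimately have "z = finprod A y (E \<union> F)"
      using A.finprod_Un_disjoint[OF fin disj] val[of _ y] y sub uv(1) by simp
    then show "z \<in> trajectory A \<alpha> (E \<union> F) X" using y unfolding trajectory_def by blast
  qed
qed

lemma trajectory_insert:
  assumes "finite F" "g \<notin> F" "g \<in> carrier G" "F \<subseteq> carrier G" "X \<subseteq> carrier A"
  shows "trajectory A \<alpha> (insert g F) X = \<alpha> g ` X <#>\<^bsub>A\<^esub> trajectory A \<alpha> F X"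
  using trajectory_Un[of "{g}" F X] trajectory_singleton[of g X] assms by simp

lemma trajectory_finite_nonempty_subset:
  assumes "finite F" "F \<subseteq> carrier G" "finite X" "X \<noteq> {}" "X \<subseteq> carrier A"
  shows "finite (trajectory A \<alpha> F X) \<and> trajectory A \<alpha> F X \<noteq> {} \<and> trajectory A \<alpha> F X \<subseteq> carrier A"
  using assms(1,2)
proof (induction F rule: finite_induct)
  case empty
  then show ?case by (simp add: trajectory_empty)
next
  case (insert g F)
  then have T: "trajectory A \<alpha> (insert g F) X = \<alpha> g ` X <#>\<^bsub>A\<^esub> trajectory A \<alpha> F X"
    using assms by (intro trajectory_insert) auto
  have "\<alpha> g ` X \<subseteq> carrier A" using insert.prems assms by (intro action_image_subset) auto
  then have "trajectory A \<alpha> (insert g F) X \<subseteq> carrier A"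
    unfolding T using insert by (intro A.set_mult_closed) auto
  then show ?case using insert assms(3,4) unfolding T by (auto simp: set_mult_def)
qed

text \<open>Keeps the argument for \<open>ent\<close> inside finite subgroups, since the bound on
  \<open>N\<close> is applied to trajectories of \<open>X\<close>. Homomorphic images of subgroups
  are subgroups, and so are products of subgroups in an abelian group.\<close>

lemma trajectory_subgroup:
  assumes "finite F" "F \<subseteq> carrier G" "subgroup X A"
  shows "subgroup (trajectory A \<alpha> F X) A"
  using assms(1,2)
proof (induction F rule: finite_induct)
  case empty
  then show ?case by (simp add: trajectory_empty A.triv_subgroup)
next
  case (insert g F)
  have "group_hom A A (\<alpha> g)"
    using action_hom insert.prems by (intro group_hom.intro group_hom_axioms.intro A.is_group) auto
  then have "subgroup (\<alpha> g ` X) A" using assms(3) by (rule group_hom.subgroup_img_is_subgroup)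
  then show ?case
    using insert trajectory_insert[of F g X] subgroup.subset[OF assms(3)] A.mult_subgroups by simp
qed

lemma trajectory_l_coset:
  assumes "finite F" "F \<subseteq> carrier G" "g \<in> carrier G" "X \<subseteq> carrier A" "finite X" "X \<noteq> {}"
  shows "trajectory A \<alpha> (g <# F) X = \<alpha> g ` trajectory A \<alpha> F X"
  using assms(1,2)
proof (induction F rule: finite_induct)
  case empty
  have "\<alpha> g \<one>\<^bsub>A\<^esub> = \<one>\<^bsub>A\<^esub>" using hom_one[OF action_hom[OF assms(3)]] A.is_group by blast
  then show ?case by (simp add: l_coset_def trajectory_empty)
next
  case (insert x F)
  let ?T = "trajectory A \<alpha> F X"
  have *: "x \<in> carrier G" "F \<subseteq> carrier G" using insert.prems by auto
  have T: "?T \<subseteq> carrier A"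
    using trajectory_finite_nonempty_subset[OF insert.hyps(1) *(2)] assms by blast
  have "g <# insert x F = insert (g \<otimes> x) (g <# F)" unfolding l_coset_def by auto
  moreover have "g \<otimes> x \<notin> g <# F"
    using insert.hyps(2) * assms(3) unfolding l_coset_def by (auto simp: subset_iff)
  moreover have "finite (g <# F)" "g <# F \<subseteq> carrier G"
    using insert.hyps(1) * assms(3) unfolding l_coset_def by auto
  ultimately have "trajectory A \<alpha> (g <# insert x F) X = \<alpha> (g \<otimes> x) ` X <#>\<^bsub>A\<^esub> trajectory A \<alpha> (g <# F) X"
    using trajectory_insert[of "g <# F" "g \<otimes> x" X] * assms by simp
  also have "\<alpha> (g \<otimes> x) ` X = \<alpha> g ` (\<alpha> x ` X)"
    unfolding image_image using action_mult[OF assms(3) *(1)] assms(4) by (intro image_cong) auto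
  also have "trajectory A \<alpha> (g <# F) X = \<alpha> g ` ?T" using insert by simp
  also have "\<alpha> g ` (\<alpha> x ` X) <#>\<^bsub>A\<^esub> \<alpha> g ` ?T = \<alpha> g ` (\<alpha> x ` X <#>\<^bsub>A\<^esub> ?T)"
    by (rule set_mult_hom[OF action_hom[OF assms(3)] action_image_subset[OF *(1) assms(4)] T, symmetric])
  also have "\<alpha> x ` X <#>\<^bsub>A\<^esub> ?T = trajectory A \<alpha> (insert x F) X"
    using trajectory_insert[of F x X] insert.hyps * assms by simp
  finally show ?case .
qed

text \<open>Injectivity makes every product \<open>n \<otimes> e\<close> arise only once; a repeated
  product would contribute several factors to the iterated trajectory but one to the trajectory
  along \<open>F <#> E\<close>.\<close>

lemma trajectory_trajectory:
  assumes "finite F" "F \<subseteq> carrier G" and E: "finite E" "E \<subseteq> carrier G"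
    and X: "X \<subseteq> carrier A" "finite X" "X \<noteq> {}"
    and inj: "inj_on (\<lambda>(n, e). n \<otimes> e) (F \<times> E)"
  shows "trajectory A \<alpha> F (trajectory A \<alpha> E X) = trajectory A \<alpha> (F <#> E) X"
  using assms(1,2) inj
proof (induction F rule: finite_induct)
  case empty
  then show ?case by (simp add: trajectory_empty set_mult_def)
next
  case (insert n F)
  let ?Y = "trajectory A \<alpha> E X"
  have *: "n \<in> carrier G" "F \<subseteq> carrier G" using insert.prems by auto
  have Y: "?Y \<subseteq> carrier A" using trajectory_finite_nonempty_subset[OF E X(2,3,1)] by blast
  have "inj_on (\<lambda>(n, e). n \<otimes> e) (F \<times> E)" using insert.prems(2) by (rule inj_on_subset) auto
  then have IH: "trajectory A \<alpha> F ?Y = trajectory A \<alpha> (F <#> E) X" using insert.IH * by blast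
  have "(n <# E) \<inter> (F <#> E) = {}"
    using insert.prems(2) insert.hyps(2) unfolding l_coset_def set_mult_def inj_on_def by fastforce
  then have "trajectory A \<alpha> ((n <# E) \<union> (F <#> E)) X
      = trajectory A \<alpha> (n <# E) X <#>\<^bsub>A\<^esub> trajectory A \<alpha> (F <#> E) X"
    using insert.hyps(1) E * X(1) l_coset_subset_G[OF E(2) *(1)] set_mult_closed[OF *(2) E(2)]
    by (intro trajectory_Un) (auto simp: l_coset_def set_mult_def)
  also have "\<dots> = \<alpha> n ` ?Y <#>\<^bsub>A\<^esub> trajectory A \<alpha> F ?Y"
    using trajectory_l_coset[OF E *(1) X] IH by simp
  also have "\<dots> = trajectory A \<alpha> (insert n F) ?Y"
    using trajectory_insert[OF insert.hyps(1,2) * Y] by simp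
  finally show ?case by (simp add: l_coset_eq_set_mult set_mult_def)
qed

section \<open>Entropy as a limit along Folner nets\<close>

lemma left_subadditive_ln_card_trajectory:
  assumes X: "finite X" "X \<noteq> {}" "X \<subseteq> carrier A"
  shows "left_subadditive G (\<lambda>F. ln (real (card (trajectory A \<alpha> F X))))"
proof unfold_locales
  let ?T = "\<lambda>F. trajectory A \<alpha> F X"
  have T: "finite (?T F)" "?T F \<noteq> {}" "?T F \<subseteq> carrier A" "0 < real (card (?T F))"
    if "finite F" "F \<subseteq> carrier G" for F
    using trajectory_finite_nonempty_subset[OF that X] by (auto simp: card_gt_0_iff)
  \<comment> \<open>Trajectories multiply over disjoint sets, so \<open>F\<close> is cut into
    \<open>E\<close> and \<open>F - E\<close>; monotonicity and subadditivity both follow from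
    this.\<close>
  have split: "?T F = ?T E <#>\<^bsub>A\<^esub> ?T (F - E)" if "E \<subseteq> F" "finite F" "F \<subseteq> carrier G" for E F
  proof -
    have "E \<union> (F - E) = F" "finite E" "finite (F - E)" "E \<subseteq> carrier G" "F - E \<subseteq> carrier G"
      using that finite_subset by auto
    then show ?thesis using trajectory_Un[of E "F - E" X] X(3) by auto
  qed
  have mono: "card (?T E) \<le> card (?T F)" if "E \<subseteq> F" "finite F" "F \<subseteq> carrier G" for E F
  proof -
    have "finite E" "finite (F - E)" "E \<subseteq> carrier G" "F - E \<subseteq> carrier G"
      using that finite_subset by auto
    then show ?thesis unfolding split[OF that] by (intro A.card_le_card_set_mult T)
  qed
  show "ln (real (card (?T {}))) = 0" by (simp add: trajectory_empty)
  show "ln (real (card (?T E))) \<le> ln (real (card (?T F)))"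
    if "E \<subseteq> F" "finite F" "F \<subseteq> carrier G" for E F
    using mono[OF that] T(4)[of E] that finite_subset by (intro ln_mono) auto
  show "ln (real (card (?T (E \<union> F)))) \<le> ln (real (card (?T E))) + ln (real (card (?T F)))"
    if "finite E" "finite F" "E \<subseteq> carrier G" "F \<subseteq> carrier G" for E F
  proof -
    have "?T (E \<union> F) = ?T E <#>\<^bsub>A\<^esub> ?T (F - E)"
      using split[of E "E \<union> F"] that by (simp add: Un_Diff Int_absorb)
    moreover have "finite (?T (F - E))" using that by (intro T(1)) auto
    ultimately have "card (?T (E \<union> F)) \<le> card (?T E) * card (?T (F - E))"
      using A.card_set_mult_le[OF T(1)] that by simp
    also have "\<dots> \<le> card (?T E) * card (?T F)" using mono[of "F - E" F] that by simp
    finally have "real (card (?T (E \<union> F))) \<le> real (card (?T E)) * real (card (?T F))"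
      by (metis of_nat_le_iff of_nat_mult)
    then have "ln (real (card (?T (E \<union> F)))) \<le> ln (real (card (?T E)) * real (card (?T F)))"
      using T(4)[of "E \<union> F"] that by (intro ln_mono) auto
    also have "\<dots> = ln (real (card (?T E))) + ln (real (card (?T F)))"
      using T(4)[of E] T(4)[of F] that by (intro ln_mult_pos) auto
    finally show ?thesis .
  qed
  show "ln (real (card (?T (g <# F)))) \<le> ln (real (card (?T F)))"
    if "g \<in> carrier G" "finite F" "F \<subseteq> carrier G" for g F
  proof -
    have "finite (g <# F)" "g <# F \<subseteq> carrier G" using that unfolding l_coset_def by auto
    then have "0 < real (card (?T (g <# F)))" by (rule T(4))
    moreover have "card (?T (g <# F)) \<le> card (?T F)"
      using trajectory_l_coset[OF that(2,3,1) X(3,1,2)] T(1)[OF that(2,3)] by (simp add: card_image_le)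
    ultimately show ?thesis by (intro ln_mono) auto
  qed
qed

text \<open>The \<open>THE\<close> in \<open>H_alg\<close> determines a value only if some Folner
  net exists on which two candidate limits must agree. The Folner condition supplies one, indexed by
  \<open>'g set\<close>.\<close>

lemma H_alg_eqI:
  assumes fc: "folner_condition G"
    and lim: "\<And>(I :: 'g set filter) F. right_folner_net G I F \<Longrightarrow>
      ((\<lambda>i. ln (real (card (trajectory A \<alpha> (F i) X))) / real (card (F i))) \<longlongrightarrow> h) I"
  shows "H_alg G A \<alpha> X = h"
  unfolding H_alg_def
proof (rule the_equality)
  show "\<forall>(I :: 'g set filter) F. right_folner_net G I F \<longrightarrow>
      ((\<lambda>i. ln (real (card (trajectory A \<alpha> (F i) X))) / real (card (F i))) \<longlongrightarrow> h) I"
    using lim by blast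
next
  fix h' assume h': "\<forall>(I :: 'g set filter) F. right_folner_net G I F \<longrightarrow>
      ((\<lambda>i. ln (real (card (trajectory A \<alpha> (F i) X))) / real (card (F i))) \<longlongrightarrow> h') I"
  obtain I :: "'g set filter" where I: "right_folner_net G I (\<lambda>D. D)"
    using ex_right_folner_net[OF fc] by blast
  then have "I \<noteq> bot" unfolding right_folner_net_def by blast
  then show "h' = h" using h'[rule_format, OF I] lim[OF I] by (rule tendsto_unique)
qed

lemma H_alg_tendsto:
  fixes I :: "'g set filter"
  assumes fc: "folner_condition G" and X: "finite X" "X \<noteq> {}" "X \<subseteq> carrier A"
    and net: "right_folner_net G I F"
  shows "((\<lambda>i. ln (real (card (trajectory A \<alpha> (F i) X))) / real (card (F i))) \<longlongrightarrow> H_alg G A \<alpha> X) I"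
proof -
  interpret f: left_subadditive G "\<lambda>F. ln (real (card (trajectory A \<alpha> F X)))"
    by (rule left_subadditive_ln_card_trajectory[OF X])
  obtain h where h: "\<And>(I :: 'g set filter) F. right_folner_net G I F \<Longrightarrow>
      ((\<lambda>i. ln (real (card (trajectory A \<alpha> (F i) X))) / real (card (F i))) \<longlongrightarrow> h) I"
    using f.ornstein_weiss[OF fc] by blast
  then show ?thesis using H_alg_eqI[OF fc h] net by blast
qed

text \<open>Extracts a single finite set from the limit; applied to \<open>N\<close>, it turns an
  entropy bound into a concrete set of small ratio.\<close>

lemma ex_trajectory_le_H_alg:
  assumes fc: "folner_condition G" and X: "finite X" "X \<noteq> {}" "X \<subseteq> carrier A"
    and C: "H_alg G A \<alpha> X < C"
  shows "\<exists>F. finite F \<and> F \<noteq> {} \<and> F \<subseteq> carrier G \<and>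
    ln (real (card (trajectory A \<alpha> F X))) \<le> C * real (card F)"
proof -
  obtain I :: "'g set filter" where I: "right_folner_net G I (\<lambda>D. D)"
    using ex_right_folner_net[OF fc] by blast
  have "\<forall>\<^sub>F D in I. ln (real (card (trajectory A \<alpha> D X))) / real (card D) < C"
    using order_tendstoD(2)[OF H_alg_tendsto[OF fc X I] C] .
  moreover have "\<forall>\<^sub>F D in I. almost_inv G {} 1 D"
    by (rule right_folner_net_almost_inv[OF I]) auto
  ultimately have "\<forall>\<^sub>F D in I. ln (real (card (trajectory A \<alpha> D X))) / real (card D) < C \<and> almost_inv G {} 1 D"
    by (rule eventually_conj)
  moreover have "I \<noteq> bot" using I unfolding right_folner_net_def by blast
  ultimately obtain D where D: "ln (real (card (trajectory A \<alpha> D X))) / real (card D) < C" "almost_inv G {} 1 D"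
    using eventually_happens by blast
  then have "finite D" "D \<noteq> {}" "D \<subseteq> carrier G" unfolding almost_inv_def by auto
  moreover from this D(1) have "ln (real (card (trajectory A \<alpha> D X))) \<le> C * real (card D)"
    by (simp add: divide_less_eq card_gt_0_iff)
  ultimately show ?thesis by blast
qed

section \<open>Normal subgroups with infinite quotient\<close>

text \<open>For \<open>k\<close> representatives \<open>E\<close> of distinct cosets and \<open>F\<close> in \<open>N\<close>, the trajectory of \<open>X\<close> along
  \<open>F E\<close> is the trajectory along \<open>F\<close> of \<open>trajectory A \<alpha> E X\<close>, so a uniform bound \<open>C\<close> on the
  \<open>N\<close>-entropies is divided by \<open>k\<close>.\<close>

lemma H_alg_eq_zero:
  assumes amen: "amenable_group G" and N: "N \<lhd> G" and inf: "infinite (carrier (G Mod N))"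
    and X: "finite X" "X \<noteq> {}" "X \<subseteq> carrier A"
    and bound: "\<And>E. finite E \<Longrightarrow> E \<subseteq> carrier G \<Longrightarrow>
      H_alg (G\<lparr>carrier := N\<rparr>) A \<alpha> (trajectory A \<alpha> E X) \<le> C"
  shows "H_alg G A \<alpha> X = 0"
proof -
  interpret f: left_subadditive G "\<lambda>F. ln (real (card (trajectory A \<alpha> F X)))"
    by (rule left_subadditive_ln_card_trajectory[OF X])
  have NG: "subgroup N G" using N by (rule normal_imp_subgroup)
  have Nsub: "N \<subseteq> carrier G" using NG by (rule subgroup.subset)
  interpret N: abelian_action "G\<lparr>carrier := N\<rparr>" A \<alpha>
  proof -
    have "left_action (G\<lparr>carrier := N\<rparr>) A \<alpha>" using action Nsub unfolding left_action_def by (simp add: subset_iff)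
    then show "abelian_action (G\<lparr>carrier := N\<rparr>) A \<alpha>"
      using subgroup_imp_group[OF NG] A.comm_group_axioms
      by (simp add: abelian_action_def abelian_action_axioms_def)
  qed
  have small: "\<exists>F. finite F \<and> F \<noteq> {} \<and> F \<subseteq> carrier G \<and>
      ln (real (card (trajectory A \<alpha> F X))) \<le> \<epsilon> * real (card F)" if "0 < \<epsilon>" for \<epsilon>
  proof -
    \<comment> \<open>Spreading over \<open>Suc k\<close> cosets divides the ratio
      \<open>C + 1\<close> down to at most \<open>\<epsilon>\<close>; the successor also keeps
      \<open>E\<close> non-empty.\<close>
    obtain k :: nat where k: "(C + 1) / \<epsilon> < real k" using reals_Archimedean2 by blast
    have "infinite (rcosets N)" using inf unfolding FactGroup_def by simp
    then obtain \<C> where \<C>: "finite \<C>" "card \<C> = Suc k" "\<C> \<subseteq> rcosets N"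
      using infinite_arbitrarily_large by blast
    have "\<forall>c\<in>\<C>. \<exists>a. a \<in> carrier G \<and> c = N #> a" using \<C>(3) unfolding RCOSETS_def by blast
    then obtain r where r: "\<And>c. c \<in> \<C> \<Longrightarrow> r c \<in> carrier G" "\<And>c. c \<in> \<C> \<Longrightarrow> c = N #> r c" by metis
    define E where "E = r ` \<C>"
    have E: "finite E" "E \<subseteq> carrier G" using \<C>(1) r(1) unfolding E_def by auto
    have "inj_on r \<C>" using r(2) by (metis inj_onI)
    then have cE: "card E = Suc k" using \<C>(2) unfolding E_def by (simp add: card_image)
    have sep: "e = e'" if "e \<in> E" "e' \<in> E" "N #> e = N #> e'" for e e'
      using that r(2) unfolding E_def by (metis imageE)
    \<comment> \<open>The coset of \<open>n \<otimes> e\<close> is that of \<open>e\<close>, which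
      determines \<open>e\<close> among the representatives, and then \<open>n\<close> by
      cancellation.\<close>
    have inj: "inj_on (\<lambda>(n, e). n \<otimes> e) (N \<times> E)"
    proof (rule inj_onI, clarify)
      fix n e n' e' assume *: "n \<in> N" "e \<in> E" "n' \<in> N" "e' \<in> E" "n \<otimes> e = n' \<otimes> e'"
      have coset: "N #> (m \<otimes> x) = N #> x" if "m \<in> N" "x \<in> E" for m x
        using that coset_mult_assoc[of N m x] coset_join2[of m N] NG Nsub E(2) by (auto simp: subset_iff)
      have "e = e'" using sep[OF *(2,4)] coset[OF *(1,2)] coset[OF *(3,4)] *(5) by simp
      then show "n = n' \<and> e = e'" using * Nsub E(2) by (simp add: subset_iff)
    qed
    let ?Y = "trajectory A \<alpha> E X"
    have Y: "finite ?Y" "?Y \<noteq> {}" "?Y \<subseteq> carrier A"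
      using trajectory_finite_nonempty_subset[OF E X] by auto
    \<comment> \<open>The increment supplies the strict inequality under which a finite set can be
      extracted from the limit.\<close>
    have "H_alg (G\<lparr>carrier := N\<rparr>) A \<alpha> ?Y < C + 1" using bound[OF E] by simp
    then obtain F where F: "finite F" "F \<noteq> {}" "F \<subseteq> N"
      "ln (real (card (trajectory A \<alpha> F ?Y))) \<le> (C + 1) * real (card F)"
      using N.ex_trajectory_le_H_alg[OF folner_condition_subgroup[OF amen NG] Y] by auto
    have FG: "F \<subseteq> carrier G" using F(3) Nsub by blast
    have injF: "inj_on (\<lambda>(n, e). n \<otimes> e) (F \<times> E)"
      using inj F(3) by (auto intro: inj_on_subset)
    have "F <#> E = (\<lambda>(n, e). n \<otimes> e) ` (F \<times> E)" unfolding set_mult_def by auto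
    then have "card (F <#> E) = card F * Suc k"
      using card_image[OF injF] cE by (simp add: card_cartesian_product)
    then have cFE: "real (card (F <#> E)) = real (card F) * real (Suc k)" by (simp only: of_nat_mult)
    have "C + 1 \<le> \<epsilon> * real (Suc k)" using k \<open>0 < \<epsilon>\<close> by (simp add: divide_less_eq algebra_simps)
    then have "(C + 1) * real (card F) \<le> \<epsilon> * real (card (F <#> E))"
      unfolding cFE using mult_right_mono[of "C + 1" "\<epsilon> * real (Suc k)" "real (card F)"]
      by (simp add: mult_ac)
    then have "ln (real (card (trajectory A \<alpha> (F <#> E) X))) \<le> \<epsilon> * real (card (F <#> E))"
      using F(4) trajectory_trajectory[OF F(1) FG E X(3,1,2) injF] by simp
    moreover have "F <#> E \<noteq> {}" using F(2) cE unfolding set_mult_def by force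
    moreover have "finite (F <#> E)" using F(1) E(1) unfolding set_mult_def by auto
    ultimately show ?thesis using set_mult_closed[OF FG E(2)] by blast
  qed
  have fc: "folner_condition G"
    using folner_condition_subgroup[OF amen subgroup_self] by simp
  show ?thesis
  proof (rule H_alg_eqI[OF fc], rule tendstoI)
    fix I :: "'g set filter" and D and e :: real
    assume net: "right_folner_net G I D" and "0 < e"
    obtain K \<delta> where K: "finite K" "K \<subseteq> carrier G" "0 < \<delta>"
      and KD: "\<And>D. almost_inv G K \<delta> D \<Longrightarrow>
        ln (real (card (trajectory A \<alpha> D X))) \<le> e / 2 * real (card D)"
      using f.almost_zero_of_small_ratio[OF small, of "e / 2"] \<open>0 < e\<close> by auto
    show "\<forall>\<^sub>F i in I. dist (ln (real (card (trajectory A \<alpha> (D i) X))) / real (card (D i))) 0 < e"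
      using right_folner_net_almost_inv[OF net K]
    proof eventually_elim
      case (elim i)
      then have D: "finite (D i)" "D i \<subseteq> carrier G" "0 < real (card (D i))"
        unfolding almost_inv_def by (auto simp: card_gt_0_iff)
      have "0 \<le> ln (real (card (trajectory A \<alpha> (D i) X))) / real (card (D i))"
        using f.f_nonneg[OF D(1,2)] by (intro divide_nonneg_nonneg) auto
      moreover have "ln (real (card (trajectory A \<alpha> (D i) X))) / real (card (D i)) \<le> e / 2"
        using KD[OF elim] D(3) by (simp add: divide_le_eq)
      ultimately show ?case using \<open>0 < e\<close> unfolding dist_real_def by linarith
    qed
  qed
qed

end

text \<open>Common to both entropies: a finite supremum gives one constant \<open>C\<close> for the
  whole family. Non-emptiness matters because the supremum of no extended reals is
  \<open>-\<infinity>\<close>, not 0.\<close>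

lemma SUP_eq_zero_of_bound:
  fixes H H' :: "'x \<Rightarrow> real"
  assumes "(SUP X\<in>\<X>. ereal (H X)) < \<infinity>" and "\<X> \<noteq> {}"
    and "\<And>C X. (\<And>Y. Y \<in> \<X> \<Longrightarrow> H Y \<le> C) \<Longrightarrow> X \<in> \<X> \<Longrightarrow> H' X = 0"
  shows "(SUP X\<in>\<X>. ereal (H' X)) = 0"
proof -
  obtain C where C: "(SUP X\<in>\<X>. ereal (H X)) \<le> ereal C"
    using assms(1) by (cases "SUP X\<in>\<X>. ereal (H X)") auto
  have "H Y \<le> C" if "Y \<in> \<X>" for Y
    using order_trans[OF SUP_upper[OF that] C] by simp
  then have "H' X = 0" if "X \<in> \<X>" for X using assms(3) that by blast
  then show ?thesis using assms(2) by (simp add: zero_ereal_def cong: SUP_cong)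
qed

theorem theorem5p12:
  fixes G :: "('g, 'm) monoid_scheme" and A :: "('a, 'n) monoid_scheme"
    and \<alpha> :: "'g \<Rightarrow> 'a \<Rightarrow> 'a" and N :: "'g set"
  assumes "amenable_group G" and "comm_group A" and "left_action G A \<alpha>"
    and "N \<lhd> G" and "N \<noteq> {\<one>\<^bsub>G\<^esub>}" and "infinite (carrier (G Mod N))"
  shows "(ent (G\<lparr>carrier := N\<rparr>) A \<alpha> < \<infinity> \<longrightarrow> ent G A \<alpha> = 0) \<and>
         (h_alg (G\<lparr>carrier := N\<rparr>) A \<alpha> < \<infinity> \<longrightarrow> h_alg G A \<alpha> = 0)"
proof -
  interpret abelian_action G A \<alpha>
    using assms(1-3) unfolding amenable_group_def abelian_action_def abelian_action_axioms_def by blast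
  note zero = H_alg_eq_zero[OF assms(1,4,6)]
  have "ent G A \<alpha> = 0" if "ent (G\<lparr>carrier := N\<rparr>) A \<alpha> < \<infinity>"
    using that unfolding ent_def
  proof (rule SUP_eq_zero_of_bound)
    show "{X. subgroup X A \<and> finite X} \<noteq> {}" using A.triv_subgroup by blast
    fix C X
    assume C: "\<And>Y. Y \<in> {X. subgroup X A \<and> finite X} \<Longrightarrow> H_alg (G\<lparr>carrier := N\<rparr>) A \<alpha> Y \<le> C"
      and X: "X \<in> {X. subgroup X A \<and> finite X}"
    then have "subgroup X A" and "finite X" by auto
    then have X': "finite X" "X \<noteq> {}" "X \<subseteq> carrier A"
      using subgroup.one_closed subgroup.subset by blast+
    show "H_alg G A \<alpha> X = 0"
      using X X' trajectory_finite_nonempty_subset[OF _ _ X']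
      by (intro zero[OF X', where C = C] C) (auto intro: trajectory_subgroup)
  qed
  moreover have "h_alg G A \<alpha> = 0" if "h_alg (G\<lparr>carrier := N\<rparr>) A \<alpha> < \<infinity>"
    using that unfolding h_alg_def
  proof (rule SUP_eq_zero_of_bound)
    show "{X. X \<subseteq> carrier A \<and> finite X \<and> X \<noteq> {}} \<noteq> {}"
      using A.one_closed by (auto intro!: exI[of _ "{\<one>\<^bsub>A\<^esub>}"])
    fix C X
    assume C: "\<And>Y. Y \<in> {X. X \<subseteq> carrier A \<and> finite X \<and> X \<noteq> {}} \<Longrightarrow> H_alg (G\<lparr>carrier := N\<rparr>) A \<alpha> Y \<le> C"
      and "X \<in> {X. X \<subseteq> carrier A \<and> finite X \<and> X \<noteq> {}}"
    then have X: "finite X" "X \<noteq> {}" "X \<subseteq> carrier A" by auto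
    show "H_alg G A \<alpha> X = 0"
      using trajectory_finite_nonempty_subset[OF _ _ X] by (intro zero[OF X, where C = C] C) auto
  qed
  ultimately show ?thesis by blast
qed

end
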